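(* Let $G$ be a finite nilpotent group such that $sd^*(G)>23/25$. Then $G$ is modular (that is, its subgroup lattice $L(G)$ is a modular lattice), and consequently $G$ is an Iwasawa group.
   Context: For a finite group $G$, $L(G)$ denotes the lattice of all subgroups of $G$. The subgroup commutativity degree of $G$ is $$sd(G)=\frac{1}{|L(G)|^2}\,\left|\{(H,K)\in L(G)^2 \mid HK=KH\}\right|,$$ the probability that two subgroups of $G$ commute. Define $sd^*(G)=\min\{sd(S)\mid S \text{ is a section of } G\}$, where a section of $G$ is a quotient $H/N$ with $N\trianglelefteq H\le G$. An Iwasawa group is a finite nilpotent group whose subgroup lattice is modular. *)

theory Defs
  imports "HOL-Algebra.Algebra" Complex_Main
begin

text \<open>The subgroup lattice L(G), as a set of subgroups (meet = intersection,
  join = generated subgroup).\<close>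
definition subgroups :: "('a, 'b) monoid_scheme \<Rightarrow> 'a set set" where
  "subgroups G = {H. subgroup H G}"

definition sd :: "('a, 'b) monoid_scheme \<Rightarrow> real" where
  "sd G = real (card {(H, K). H \<in> subgroups G \<and> K \<in> subgroups G
                              \<and> H <#>\<^bsub>G\<^esub> K = K <#>\<^bsub>G\<^esub> H})
          / (real (card (subgroups G)))^2"

definition sections :: "('a, 'b) monoid_scheme \<Rightarrow> 'a set monoid set" where
  "sections G = {(G\<lparr>carrier := H\<rparr>) Mod N | H N.
                   subgroup H G \<and> N \<lhd> G\<lparr>carrier := H\<rparr>}"

definition sd_star :: "('a, 'b) monoid_scheme \<Rightarrow> real" where
  "sd_star G = Min (sd ` sections G)"

fun lower_central :: "('a, 'b) monoid_scheme \<Rightarrow> nat \<Rightarrow> 'a set" where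
  "lower_central G 0 = carrier G"
| "lower_central G (Suc n) = generate G
     (\<Union>x \<in> lower_central G n. \<Union>y \<in> carrier G.
        {x \<otimes>\<^bsub>G\<^esub> y \<otimes>\<^bsub>G\<^esub> inv\<^bsub>G\<^esub> x \<otimes>\<^bsub>G\<^esub> inv\<^bsub>G\<^esub> y})"

definition nilpotent_group :: "('a, 'b) monoid_scheme \<Rightarrow> bool" where
  "nilpotent_group G \<longleftrightarrow> group G \<and> (\<exists>n. lower_central G n = {\<one>\<^bsub>G\<^esub>})"

definition modular_group :: "('a, 'b) monoid_scheme \<Rightarrow> bool" where
  "modular_group G \<longleftrightarrow> (\<forall>H \<in> subgroups G. \<forall>K \<in> subgroups G. \<forall>L \<in> subgroups G.
     H \<subseteq> L \<longrightarrow> generate G (H \<union> K) \<inter> L = generate G (H \<union> (K \<inter> L)))"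

definition iwasawa_group :: "('a, 'b) monoid_scheme \<Rightarrow> bool" where
  "iwasawa_group G \<longleftrightarrow> finite (carrier G) \<and> nilpotent_group G \<and> modular_group G"

end

theory Submission
  imports Defs
begin

text \<open>
  If any two subgroups of \<open>G\<close> commute then \<open>L(G)\<close> is modular by the Dedekind law, so suppose that
  some do not. Choose a section \<open>S\<close> of \<open>G\<close> that is minimal with non-commuting subgroups, and in it
  such a pair \<open>A\<close>, \<open>B\<close> with \<open>|A| + |B|\<close> minimal. Then \<open>A\<close> and \<open>B\<close> are cyclic with unique maximal
  subgroups \<open>A1\<close> and \<open>B1\<close>, and \<open>S = A B M\<close> for every minimal central subgroup \<open>M\<close>. The subgroups
  \<open>A1 B M\<close> and \<open>B1 A M\<close> are maximal, hence normal because \<open>S\<close> is nilpotent, and their intersection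
  is \<open>A1 B1 M\<close>. An element of it outside \<open>M\<close> that is central modulo \<open>M\<close> would produce a nontrivial
  central element of \<open>S\<close> in \<open>A\<close> or \<open>B\<close>, against the minimality of \<open>S\<close>; so \<open>A1\<close> and \<open>B1\<close> are
  trivial, \<open>A\<close>, \<open>B\<close>, \<open>M\<close> have the same order \<open>p\<close>, and all commutators lie in \<open>M\<close>.

  Let \<open>n\<close> be the number of nontrivial subgroups of \<open>S\<close> that meet \<open>M\<close> trivially. Two of them, \<open>U\<close> and
  \<open>V\<close>, commute only if \<open>U M = V M\<close>, and each fibre of \<open>U \<mapsto> U M\<close> has at most \<open>p\<close> elements. The
  conjugates of \<open>A\<close> and of \<open>B\<close> give \<open>n \<ge> 2 p\<close>, and at most \<open>p + 3\<close> subgroups contain \<open>M\<close>. Hence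
  \<open>sd S \<le> 1 - n (n - p) / (n + p + 4)\<^sup>2 \<le> 23 / 25\<close>, with equality for the dihedral group of
  order 8.
\<close>

section \<open>Products of subgroups\<close>

lemma set_multI: "\<lbrakk>h \<in> H; k \<in> K\<rbrakk> \<Longrightarrow> h \<otimes>\<^bsub>G\<^esub> k \<in> H <#>\<^bsub>G\<^esub> K"
  by (auto simp: set_mult_def)

lemma set_multE:
  assumes "x \<in> H <#>\<^bsub>G\<^esub> K"
  obtains h k where "h \<in> H" "k \<in> K" "x = h \<otimes>\<^bsub>G\<^esub> k"
  using assms by (auto simp: set_mult_def)

context group
begin

text \<open>Once a word is bracketed to the right, an inverse pair no longer forms a subterm of its
  own. These rules cancel it in that position, so \<open>word_simps\<close> settles identities of
  group words that follow by cancellation alone.\<close>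

lemma mult_inv_cancel:
  assumes "x \<in> carrier G" "y \<in> carrier G"
  shows "x \<otimes> (inv x \<otimes> y) = y" "inv x \<otimes> (x \<otimes> y) = y"
  using assms by (simp_all flip: m_assoc)

lemmas word_simps = m_assoc inv_mult_group mult_inv_cancel

lemma set_mult_memI1: "\<lbrakk>subgroup H G; subgroup K G; x \<in> H\<rbrakk> \<Longrightarrow> x \<in> H <#> K"
  using set_multI[of x H \<one> K G] by (simp add: subgroup.one_closed subgroup.mem_carrier)

lemma set_mult_memI2: "\<lbrakk>subgroup H G; subgroup K G; x \<in> K\<rbrakk> \<Longrightarrow> x \<in> H <#> K"
  using set_multI[of \<one> H x K G] by (simp add: subgroup.one_closed subgroup.mem_carrier)

text \<open>Inversion exchanges \<open>H <#> K\<close> and \<open>K <#> H\<close>, so an inclusion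
  in one direction yields the other.\<close>

lemma set_mult_commute_if_subset:
  assumes H: "subgroup H G" and K: "subgroup K G" and sub: "H <#> K \<subseteq> K <#> H"
  shows "H <#> K = K <#> H"
proof
  show "K <#> H \<subseteq> H <#> K"
  proof
    fix x assume "x \<in> K <#> H"
    then obtain k h where kh: "k \<in> K" "h \<in> H" "x = k \<otimes> h" by (rule set_multE)
    have "inv h \<otimes> inv k \<in> H <#> K"
      using kh H K by (intro set_multI) (auto intro: subgroup.m_inv_closed)
    then obtain k' h' where kh': "k' \<in> K" "h' \<in> H" "inv h \<otimes> inv k = k' \<otimes> h'"
      using sub by (blast elim: set_multE)
    have c: "k \<in> carrier G" "h \<in> carrier G" "k' \<in> carrier G" "h' \<in> carrier G"
      using kh kh' H K by (auto intro: subgroup.mem_carrier)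
    have "x = inv (inv h \<otimes> inv k)" using kh c by (simp add: inv_mult_group)
    also have "\<dots> = inv h' \<otimes> inv k'" using kh' c by (simp add: inv_mult_group)
    finally show "x \<in> H <#> K"
      using kh' H K by (auto intro: set_multI subgroup.m_inv_closed)
  qed
qed (rule sub)

lemma subgroup_set_mult:
  assumes H: "subgroup H G" and K: "subgroup K G" and c: "H <#> K = K <#> H"
  shows "subgroup (H <#> K) G"
proof (rule subgroupI)
  show "H <#> K \<subseteq> carrier G"
    using H K by (simp add: setmult_subset_G subgroup.subset)
  show "H <#> K \<noteq> {}"
    using set_mult_memI1[OF H K] subgroup.one_closed[OF H] by blast
next
  fix x assume "x \<in> H <#> K"
  then obtain h k where hk: "h \<in> H" "k \<in> K" "x = h \<otimes> k" by (rule set_multE)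
  then have "inv x = inv k \<otimes> inv h"
    using H K by (meson inv_mult_group subgroup.mem_carrier)
  then have "inv x \<in> K <#> H"
    using hk H K by (auto intro: set_multI subgroup.m_inv_closed)
  then show "inv x \<in> H <#> K" by (simp add: c)
next
  fix x y assume "x \<in> H <#> K" "y \<in> H <#> K"
  then obtain h k h' k' where hk: "h \<in> H" "k \<in> K" "x = h \<otimes> k" "h' \<in> H" "k' \<in> K" "y = h' \<otimes> k'"
    by (metis set_multE)
  have "k \<otimes> h' \<in> H <#> K" using hk c by (metis set_multI)
  then obtain h2 k2 where 2: "h2 \<in> H" "k2 \<in> K" "k \<otimes> h' = h2 \<otimes> k2" by (rule set_multE)
  have car: "h \<in> carrier G" "k \<in> carrier G" "h' \<in> carrier G" "k' \<in> carrier G"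
    "h2 \<in> carrier G" "k2 \<in> carrier G"
    using hk 2 H K by (auto intro: subgroup.mem_carrier)
  have "x \<otimes> y = h \<otimes> (k \<otimes> h') \<otimes> k'" using hk car by (simp add: m_assoc)
  also have "\<dots> = (h \<otimes> h2) \<otimes> (k2 \<otimes> k')" using 2 car by (simp add: m_assoc)
  finally show "x \<otimes> y \<in> H <#> K"
    using hk 2 H K by (auto intro: set_multI subgroup.m_closed)
qed

lemma set_mult_subset_subgroup:
  assumes "subgroup T G" "H \<subseteq> T" "K \<subseteq> T"
  shows "H <#> K \<subseteq> T"
  using assms by (auto elim!: set_multE intro: subgroup.m_closed)

lemma set_mult_commute_if_covers:
  assumes H: "subgroup H G" and K: "subgroup K G" and "carrier G \<subseteq> H <#> K"
  shows "H <#> K = K <#> H"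
proof -
  have "K <#> H \<subseteq> carrier G"
    using H K by (intro setmult_subset_G subgroup.subset)
  then have "K <#> H \<subseteq> H <#> K" using assms(3) by blast
  then show ?thesis using set_mult_commute_if_subset[OF K H] by simp
qed

lemma dedekind_law:
  assumes H: "subgroup H G" and L: "subgroup L G" and "K \<subseteq> carrier G" and "H \<subseteq> L"
  shows "(H <#> K) \<inter> L = H <#> (K \<inter> L)"
proof
  show "H <#> (K \<inter> L) \<subseteq> (H <#> K) \<inter> L"
    using assms by (auto elim!: set_multE intro: set_multI subgroup.m_closed)
  show "(H <#> K) \<inter> L \<subseteq> H <#> (K \<inter> L)"
  proof
    fix x assume x: "x \<in> (H <#> K) \<inter> L"
    then obtain h k where hk: "h \<in> H" "k \<in> K" "x = h \<otimes> k" by (blast elim: set_multE)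
    have "k = inv h \<otimes> x"
      using hk assms by (metis inv_solve_left subgroup.mem_carrier subsetD m_closed)
    then have "k \<in> L"
      using hk x assms by (metis IntD2 subgroup.m_closed subgroup.m_inv_closed subsetD)
    with hk show "x \<in> H <#> (K \<inter> L)" by (auto intro: set_multI)
  qed
qed

text \<open>If all subgroups commute, joins are products, and the modular law becomes
  \<open>dedekind_law\<close>.\<close>

lemma commuting_subgroups_imp_modular:
  assumes "\<And>H K. \<lbrakk>subgroup H G; subgroup K G\<rbrakk> \<Longrightarrow> H <#> K = K <#> H"
  shows "modular_group G"
proof -
  have gen: "generate G (H \<union> K) = H <#> K" if H: "subgroup H G" and K: "subgroup K G" for H K
  proof
    have "H \<union> K \<subseteq> H <#> K"
      using set_mult_memI1[OF H K] set_mult_memI2[OF H K] by blast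
    then show "generate G (H \<union> K) \<subseteq> H <#> K"
      using generate_subgroup_incl subgroup_set_mult[OF H K assms[OF H K]] by blast
    have "H \<union> K \<subseteq> carrier G" using H K by (simp add: subgroup.subset)
    then show "H <#> K \<subseteq> generate G (H \<union> K)"
      by (meson Un_upper1 Un_upper2 generate.incl generate_is_subgroup set_mult_subset_subgroup subset_iff)
  qed
  show ?thesis
    unfolding modular_group_def subgroups_def
    by (auto simp: gen subgroups_Inter_pair dedekind_law subgroup.subset)
qed

text \<open>The set is the preimage of the centralizer of the image of \<open>t\<close> in the
  quotient by \<open>M\<close>. Phrasing it by commutators keeps later arguments modulo
  \<open>M\<close> inside \<open>G\<close>.\<close>

lemma subgroup_commuting_mod:
  assumes M: "subgroup M G" and cent: "\<And>m x. \<lbrakk>m \<in> M; x \<in> carrier G\<rbrakk> \<Longrightarrow> m \<otimes> x = x \<otimes> m"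
    and t: "t \<in> carrier G"
  shows "subgroup {s \<in> carrier G. s \<otimes> t \<otimes> inv s \<otimes> inv t \<in> M} G"
proof (rule subgroupI)
  show "{s \<in> carrier G. s \<otimes> t \<otimes> inv s \<otimes> inv t \<in> M} \<noteq> {}"
    using t M by (auto intro!: exI[of _ \<one>] simp: subgroup.one_closed)
next
  fix s assume "s \<in> {s \<in> carrier G. s \<otimes> t \<otimes> inv s \<otimes> inv t \<in> M}"
  then have s: "s \<in> carrier G" and m: "s \<otimes> t \<otimes> inv s \<otimes> inv t \<in> M" by auto
  let ?m = "s \<otimes> t \<otimes> inv s \<otimes> inv t"
  have "inv s \<otimes> t \<otimes> inv (inv s) \<otimes> inv t = inv s \<otimes> (inv ?m \<otimes> s)"
    using s t by (simp add: word_simps)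
  also have "\<dots> = inv s \<otimes> (s \<otimes> inv ?m)"
    using cent[of "inv ?m" s] m s M by (simp add: subgroup.m_inv_closed)
  also have "\<dots> = inv ?m" using s t by (simp add: mult_inv_cancel)
  finally show "inv s \<in> {s \<in> carrier G. s \<otimes> t \<otimes> inv s \<otimes> inv t \<in> M}"
    using s m M by (simp add: subgroup.m_inv_closed)
next
  fix s s' assume a: "s \<in> {s \<in> carrier G. s \<otimes> t \<otimes> inv s \<otimes> inv t \<in> M}"
    "s' \<in> {s \<in> carrier G. s \<otimes> t \<otimes> inv s \<otimes> inv t \<in> M}"
  then have s: "s \<in> carrier G" "s' \<in> carrier G" by auto
  let ?m = "s' \<otimes> t \<otimes> inv s' \<otimes> inv t"
  have "(s \<otimes> s') \<otimes> t \<otimes> inv (s \<otimes> s') \<otimes> inv t = s \<otimes> ?m \<otimes> (t \<otimes> inv s \<otimes> inv t)"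
    using s t by (simp add: word_simps)
  also have "\<dots> = ?m \<otimes> s \<otimes> (t \<otimes> inv s \<otimes> inv t)"
    using cent[of ?m s] a s by simp
  also have "\<dots> = ?m \<otimes> (s \<otimes> t \<otimes> inv s \<otimes> inv t)"
    using s t by (simp add: word_simps)
  finally show "s \<otimes> s' \<in> {s \<in> carrier G. s \<otimes> t \<otimes> inv s \<otimes> inv t \<in> M}"
    using a s M by (simp add: subgroup.m_closed)
qed auto

lemma subgroup_centralizer:
  assumes T: "T \<subseteq> carrier G"
  shows "subgroup {s \<in> carrier G. \<forall>t\<in>T. s \<otimes> t = t \<otimes> s} G"
proof (rule subgroupI)
  show "{s \<in> carrier G. \<forall>t\<in>T. s \<otimes> t = t \<otimes> s} \<noteq> {}"
    using T by (auto intro!: exI[of _ \<one>])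
next
  fix s assume s: "s \<in> {s \<in> carrier G. \<forall>t\<in>T. s \<otimes> t = t \<otimes> s}"
  have "inv s \<otimes> t = t \<otimes> inv s" if t: "t \<in> T" for t
  proof -
    have c: "s \<in> carrier G" "t \<in> carrier G" using s t T by auto
    have "inv s \<otimes> t = inv s \<otimes> (t \<otimes> s) \<otimes> inv s" using c by (simp add: word_simps)
    also have "t \<otimes> s = s \<otimes> t" using s t by simp
    finally show ?thesis using c by (simp add: word_simps)
  qed
  then show "inv s \<in> {s \<in> carrier G. \<forall>t\<in>T. s \<otimes> t = t \<otimes> s}" using s by simp
next
  fix s s' assume s: "s \<in> {s \<in> carrier G. \<forall>t\<in>T. s \<otimes> t = t \<otimes> s}"
    and s': "s' \<in> {s \<in> carrier G. \<forall>t\<in>T. s \<otimes> t = t \<otimes> s}"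
  have "s \<otimes> s' \<otimes> t = t \<otimes> (s \<otimes> s')" if t: "t \<in> T" for t
  proof -
    have c: "s \<in> carrier G" "s' \<in> carrier G" "t \<in> carrier G" using s s' t T by auto
    have "s \<otimes> s' \<otimes> t = s \<otimes> (t \<otimes> s')" using c s' t by (simp add: m_assoc)
    also have "\<dots> = (s \<otimes> t) \<otimes> s'" using c by (simp add: m_assoc)
    also have "s \<otimes> t = t \<otimes> s" using s t by simp
    finally show ?thesis using c by (simp add: m_assoc)
  qed
  then show "s \<otimes> s' \<in> {s \<in> carrier G. \<forall>t\<in>T. s \<otimes> t = t \<otimes> s}" using s s' by simp
qed auto

text \<open>Serves to rule out certain factorizations \<open>H <#> K\<close> of a nonabelian
  group.\<close>

lemma commute_if_product:
  assumes H: "subgroup H G" and K: "subgroup K G" and cov: "carrier G \<subseteq> H <#> K"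
    and hh: "\<And>x y. \<lbrakk>x \<in> H; y \<in> H\<rbrakk> \<Longrightarrow> x \<otimes> y = y \<otimes> x"
    and kk: "\<And>x y. \<lbrakk>x \<in> K; y \<in> K\<rbrakk> \<Longrightarrow> x \<otimes> y = y \<otimes> x"
    and hk: "\<And>x y. \<lbrakk>x \<in> H; y \<in> K\<rbrakk> \<Longrightarrow> x \<otimes> y = y \<otimes> x"
    and s: "s \<in> carrier G" and t: "t \<in> carrier G"
  shows "s \<otimes> t = t \<otimes> s"
proof -
  obtain h k where 1: "h \<in> H" "k \<in> K" "s = h \<otimes> k" using cov s by (blast elim: set_multE)
  obtain h' k' where 2: "h' \<in> H" "k' \<in> K" "t = h' \<otimes> k'" using cov t by (blast elim: set_multE)
  have c: "h \<in> carrier G" "k \<in> carrier G" "h' \<in> carrier G" "k' \<in> carrier G"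
    using 1 2 H K by (auto intro: subgroup.mem_carrier)
  have "s \<otimes> t = h \<otimes> (k \<otimes> h') \<otimes> k'" using 1 2 c by (simp add: m_assoc)
  also have "k \<otimes> h' = h' \<otimes> k" using hk[OF 2(1) 1(2)] by simp
  also have "h \<otimes> (h' \<otimes> k) \<otimes> k' = (h \<otimes> h') \<otimes> (k \<otimes> k')" using c by (simp add: m_assoc)
  also have "\<dots> = (h' \<otimes> h) \<otimes> (k' \<otimes> k)" using hh[OF 1(1) 2(1)] kk[OF 1(2) 2(2)] by simp
  also have "\<dots> = h' \<otimes> (h \<otimes> k') \<otimes> k" using c by (simp add: m_assoc)
  also have "h \<otimes> k' = k' \<otimes> h" using hk[OF 1(1) 2(2)] .
  also have "h' \<otimes> (k' \<otimes> h) \<otimes> k = t \<otimes> s" using 1 2 c by (simp add: m_assoc)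
  finally show ?thesis .
qed

lemma set_mult3E:
  assumes "s \<in> H <#> K <#> L"
  obtains x y z where "x \<in> H" "y \<in> K" "z \<in> L" "s = x \<otimes> y \<otimes> z"
proof -
  obtain u z where u: "u \<in> H <#> K" "z \<in> L" "s = u \<otimes> z" using assms by (rule set_multE)
  obtain x y where "x \<in> H" "y \<in> K" "u = x \<otimes> y" using u(1) by (rule set_multE)
  with u show thesis using that by blast
qed

text \<open>Reduces a claim about all of \<open>G\<close> to the three factors of a decomposition;
  \<open>T\<close> is often a centralizer, possibly modulo a central subgroup, or a
  normalizer.\<close>

lemma subgroup_covers:
  assumes T: "subgroup T G" "H \<subseteq> T" "K \<subseteq> T" "L \<subseteq> T" and cov: "carrier G \<subseteq> H <#> K <#> L"
  shows "T = carrier G"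
proof -
  have "H <#> K <#> L \<subseteq> T"
    using T by (intro set_mult_subset_subgroup) auto
  then show ?thesis using T(1) cov subgroup.subset by blast
qed

lemma set_mult_absorb:
  assumes H: "subgroup H G" and K: "subgroup K G" and "K \<subseteq> H"
  shows "H <#> K = H" "K <#> H = H"
proof -
  show "H <#> K = H"
    using set_mult_subset_subgroup[OF H subset_refl assms(3)] set_mult_memI1[OF H K] by blast
  show "K <#> H = H"
    using set_mult_subset_subgroup[OF H assms(3) subset_refl] set_mult_memI2[OF K H] by blast
qed

lemma central_normal:
  assumes W: "subgroup W G" and c: "\<And>w x. \<lbrakk>w \<in> W; x \<in> carrier G\<rbrakk> \<Longrightarrow> w \<otimes> x = x \<otimes> w"
  shows "W \<lhd> G"
  unfolding normal_inv_iff
proof (intro conjI ballI W)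
  fix x h assume x: "x \<in> carrier G" and h: "h \<in> W"
  have hc: "h \<in> carrier G" by (rule subgroup.mem_carrier[OF W h])
  have "x \<otimes> h \<otimes> inv x = h" using c[OF h x, symmetric] x hc by (simp add: word_simps)
  then show "x \<otimes> h \<otimes> inv x \<in> W" using h by simp
qed

lemma generate_central:
  assumes d: "d \<in> carrier G" and c: "\<And>x. x \<in> carrier G \<Longrightarrow> d \<otimes> x = x \<otimes> d"
    and w: "w \<in> generate G {d}" and x: "x \<in> carrier G"
  shows "w \<otimes> x = x \<otimes> w"
proof -
  have "generate G {d} \<subseteq> {s \<in> carrier G. \<forall>t\<in>carrier G. s \<otimes> t = t \<otimes> s}"
    by (rule generate_subgroup_incl[OF _ subgroup_centralizer]) (use c d in auto)
  then show ?thesis using w x by blast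
qed

lemma subgroup_mult_central:
  assumes H: "subgroup H G" and M: "subgroup M G"
    and c: "\<And>m x. \<lbrakk>m \<in> M; x \<in> carrier G\<rbrakk> \<Longrightarrow> m \<otimes> x = x \<otimes> m"
  shows "subgroup (H <#> M) G"
  by (rule subgroup_set_mult[OF H M commut_normal[OF H central_normal[OF M c]]])

lemma generate_singleton_minimal: "\<lbrakk>subgroup H G; x \<in> H\<rbrakk> \<Longrightarrow> generate G {x} \<subseteq> H"
  by (rule generate_subgroup_incl) auto

lemma generate_singleton_self: "x \<in> generate G {x}"
  by (rule generate.incl) simp

lemma generate_singleton_subgroup: "x \<in> carrier G \<Longrightarrow> subgroup (generate G {x}) G"
  by (rule generate_is_subgroup) simp

end

section \<open>Counting subgroups\<close>

text \<open>These are the subgroups counted by \<open>n\<close> in the overview. If \<open>M\<close>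
  is minimal, every other nontrivial subgroup contains \<open>M\<close>.\<close>

definition avoiding :: "('a, 'b) monoid_scheme \<Rightarrow> 'a set \<Rightarrow> 'a set set" where
  "avoiding G M = {U. subgroup U G \<and> U \<noteq> {\<one>\<^bsub>G\<^esub>} \<and> U \<inter> M = {\<one>\<^bsub>G\<^esub>}}"

text \<open>The situation at the end of the reduction. \<open>minA\<close>, \<open>minB\<close> and
  \<open>minM\<close> encode prime order without mentioning primes. \<open>commutator_AB\<close>
  concerns only \<open>A\<close> and \<open>B\<close>; its extension to all of \<open>G\<close> is
  \<open>commutator_in_M\<close>.\<close>

locale minimal_triple = group G for G (structure) +
  fixes A B M
  assumes fin: "finite (carrier G)"
    and sgA: "subgroup A G" and sgB: "subgroup B G" and sgM: "subgroup M G"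
    and minA: "\<lbrakk>subgroup C G; C \<subseteq> A\<rbrakk> \<Longrightarrow> C = {\<one>} \<or> C = A"
    and minB: "\<lbrakk>subgroup C G; C \<subseteq> B\<rbrakk> \<Longrightarrow> C = {\<one>} \<or> C = B"
    and minM: "\<lbrakk>subgroup C G; C \<subseteq> M\<rbrakk> \<Longrightarrow> C = {\<one>} \<or> C = M"
    and M_nontrivial: "M \<noteq> {\<one>}"
    and M_central: "\<lbrakk>m \<in> M; x \<in> carrier G\<rbrakk> \<Longrightarrow> m \<otimes> x = x \<otimes> m"
    and A_comm: "\<lbrakk>x \<in> A; y \<in> A\<rbrakk> \<Longrightarrow> x \<otimes> y = y \<otimes> x"
    and B_comm: "\<lbrakk>x \<in> B; y \<in> B\<rbrakk> \<Longrightarrow> x \<otimes> y = y \<otimes> x"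
    and commutator_AB: "\<lbrakk>x \<in> A; y \<in> B\<rbrakk> \<Longrightarrow> x \<otimes> y \<otimes> inv x \<otimes> inv y \<in> M"
    and decomp: "carrier G \<subseteq> A <#> B <#> M"
    and AB_not_commute: "A <#> B \<noteq> B <#> A"
begin

section \<open>Commutators and orders in a minimal triple\<close>

lemma A_carrier: "x \<in> A \<Longrightarrow> x \<in> carrier G"
  and B_carrier: "x \<in> B \<Longrightarrow> x \<in> carrier G"
  and M_carrier: "x \<in> M \<Longrightarrow> x \<in> carrier G"
  using sgA sgB sgM by (auto intro: subgroup.mem_carrier)

lemmas car = A_carrier B_carrier M_carrier

lemma decompE:
  assumes "s \<in> carrier G"
  obtains x y m where "x \<in> A" "y \<in> B" "m \<in> M" "s = x \<otimes> y \<otimes> m"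
  by (rule set_mult3E[OF subsetD[OF decomp assms]])

text \<open>By this symmetry every fact about \<open>A\<close> can be reused for \<open>B\<close>.
  The two checks that are not immediate use inverses: exchanging \<open>x\<close> and
  \<open>y\<close> inverts their commutator, and inverting \<open>inv s\<close> reverses its three
  factors.\<close>

lemma swap: "minimal_triple G B A M"
proof (intro minimal_triple.intro minimal_triple_axioms.intro)
  fix x y assume xy: "x \<in> B" "y \<in> A"
  have "inv (y \<otimes> x \<otimes> inv y \<otimes> inv x) \<in> M"
    using commutator_AB[OF xy(2,1)] sgM by (simp add: subgroup.m_inv_closed)
  then show "x \<otimes> y \<otimes> inv x \<otimes> inv y \<in> M"
    using xy car by (simp add: word_simps)
next
  show "carrier G \<subseteq> B <#> A <#> M"
  proof
    fix s assume s: "s \<in> carrier G"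
    obtain x y m where xym: "x \<in> A" "y \<in> B" "m \<in> M" "inv s = x \<otimes> y \<otimes> m"
      by (rule decompE[OF inv_closed[OF s]])
    then have c: "x \<in> carrier G" "y \<in> carrier G" "m \<in> carrier G" by (auto intro: car)
    have "s = inv (inv s)" using s by simp
    also have "\<dots> = inv m \<otimes> (inv y \<otimes> inv x)" using xym c by (simp add: word_simps)
    also have "\<dots> = (inv y \<otimes> inv x) \<otimes> inv m"
      using M_central[of "inv m" "inv y \<otimes> inv x"] xym c sgM by (simp add: subgroup.m_inv_closed)
    finally show "s \<in> B <#> A <#> M"
      using xym sgA sgB sgM by (auto intro!: set_multI simp: subgroup.m_inv_closed)
  qed
qed (fact is_group fin sgA sgB sgM minA minB minM M_nontrivial M_central A_comm B_comm
    AB_not_commute[symmetric])+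

text \<open>If \<open>x\<close> and \<open>y\<close> commuted, minimality would propagate this: the
  centralizer of \<open>y\<close> meets \<open>A\<close> nontrivially and so contains
  \<open>A\<close>, then the centralizer of \<open>A\<close> contains \<open>B\<close>, and
  \<open>A <#> B = B <#> A\<close>.\<close>

lemma not_commute:
  assumes "x \<in> A" "y \<in> B" "x \<noteq> \<one>" "y \<noteq> \<one>"
  shows "x \<otimes> y \<noteq> y \<otimes> x"
proof
  assume xy: "x \<otimes> y = y \<otimes> x"
  have "subgroup (A \<inter> {s \<in> carrier G. \<forall>t\<in>{y}. s \<otimes> t = t \<otimes> s}) G"
    using assms car by (intro subgroups_Inter_pair sgA subgroup_centralizer) auto
  then have "A \<inter> {s \<in> carrier G. \<forall>t\<in>{y}. s \<otimes> t = t \<otimes> s} = A"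
    using minA[of "A \<inter> {s \<in> carrier G. \<forall>t\<in>{y}. s \<otimes> t = t \<otimes> s}"] assms xy car by blast
  then have y: "y \<otimes> s = s \<otimes> y" if "s \<in> A" for s using that by force
  have "subgroup (B \<inter> {s \<in> carrier G. \<forall>t\<in>A. s \<otimes> t = t \<otimes> s}) G"
    using car by (intro subgroups_Inter_pair sgB subgroup_centralizer) auto
  then have "B \<inter> {s \<in> carrier G. \<forall>t\<in>A. s \<otimes> t = t \<otimes> s} = B"
    using minB[of "B \<inter> {s \<in> carrier G. \<forall>t\<in>A. s \<otimes> t = t \<otimes> s}"] assms y car by blast
  then have "s \<otimes> t = t \<otimes> s" if "s \<in> A" "t \<in> B" for s t
    using that by force
  then have "A <#> B \<subseteq> B <#> A"
    unfolding set_mult_def by force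
  then show False
    using set_mult_commute_if_subset[OF sgA sgB] AB_not_commute by blast
qed

lemma A_nontrivial: "A \<noteq> {\<one>}"
proof
  assume A: "A = {\<one>}"
  have "A <#> B = B <#> A" using car unfolding A set_mult_def by auto
  then show False using AB_not_commute by simp
qed

lemma A_obtain: obtains a where "a \<in> A" "a \<noteq> \<one>"
  using A_nontrivial subgroup.one_closed[OF sgA] by blast

lemma B_obtain: obtains b where "b \<in> B" "b \<noteq> \<one>"
  by (rule minimal_triple.A_obtain[OF swap])

lemma A_Int_M:
  assumes "x \<in> A" "x \<in> M"
  shows "x = \<one>"
proof (rule ccontr)
  assume "x \<noteq> \<one>"
  obtain b where "b \<in> B" "b \<noteq> \<one>" by (rule B_obtain)
  then show False
    using not_commute[of x b] M_central[of x b] B_carrier[of b] assms \<open>x \<noteq> \<one>\<close> by blast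
qed

lemmas covers = subgroup_covers[OF _ _ _ _ decomp]

text \<open>\<open>C t\<close> is the centralizer of \<open>t\<close> modulo \<open>M\<close>. Its
  membership relation is symmetric, which allows two rounds of \<open>covers\<close>: first for
  \<open>C x\<close> with \<open>x\<close> in \<open>A\<close> or \<open>B\<close>, and then,
  \<open>A\<close> and \<open>B\<close> lying in every \<open>C t\<close>, for arbitrary
  \<open>t\<close>.\<close>

lemma commutator_in_M:
  assumes "s \<in> carrier G" "t \<in> carrier G"
  shows "s \<otimes> t \<otimes> inv s \<otimes> inv t \<in> M"
proof -
  define C where "C t = {s \<in> carrier G. s \<otimes> t \<otimes> inv s \<otimes> inv t \<in> M}" for t
  have sgC: "subgroup (C t) G" if "t \<in> carrier G" for t
    unfolding C_def using subgroup_commuting_mod[OF sgM M_central that] by blast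
  have sym: "s \<in> C t" if "t \<in> C s" "s \<in> carrier G" for s t
  proof -
    have "inv (t \<otimes> s \<otimes> inv t \<otimes> inv s) \<in> M"
      using that sgM unfolding C_def by (simp add: subgroup.m_inv_closed)
    then show ?thesis using that unfolding C_def by (auto simp: word_simps)
  qed
  have MC: "M \<subseteq> C t" if t: "t \<in> carrier G" for t
  proof
    fix m assume m: "m \<in> M"
    have "m \<otimes> t \<otimes> inv m \<otimes> inv t = \<one>"
      using M_central[OF m t] m t car by (simp add: word_simps)
    then show "m \<in> C t"
      using m sgM car by (simp add: C_def subgroup.one_closed)
  qed
  have AA: "A \<subseteq> C x" if x: "x \<in> A" for x
  proof
    fix y assume y: "y \<in> A"
    have "y \<otimes> x \<otimes> inv y \<otimes> inv x = \<one>"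
      using A_comm[OF y x] x y car by (simp add: word_simps)
    then show "y \<in> C x" using y sgM car by (simp add: C_def subgroup.one_closed)
  qed
  have BB: "B \<subseteq> C x" if x: "x \<in> B" for x
  proof
    fix y assume y: "y \<in> B"
    have "y \<otimes> x \<otimes> inv y \<otimes> inv x = \<one>"
      using B_comm[OF y x] x y car by (simp add: word_simps)
    then show "y \<in> C x" using y sgM car by (simp add: C_def subgroup.one_closed)
  qed
  have AB: "A \<subseteq> C y" if "y \<in> B" for y
    using that commutator_AB car by (auto simp: C_def)
  have BA: "B \<subseteq> C x" if "x \<in> A" for x
    using that AB sym car by blast
  have CA: "C x = carrier G" if "x \<in> A" for x
    using that AA BA MC sgC car by (intro covers) auto
  have CB: "C x = carrier G" if "x \<in> B" for x
    using that AB BB MC sgC car by (intro covers) auto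
  have "C t = carrier G"
    using assms CA CB sym MC sgC car by (intro covers) auto
  then show ?thesis using assms unfolding C_def by blast
qed

lemma commute_mod:
  assumes "s \<in> carrier G" "t \<in> carrier G"
  obtains m where "m \<in> M" "s \<otimes> t = t \<otimes> s \<otimes> m"
proof
  let ?m = "s \<otimes> t \<otimes> inv s \<otimes> inv t"
  show m: "?m \<in> M" using commutator_in_M assms by blast
  have "s \<otimes> t = ?m \<otimes> (t \<otimes> s)" using assms by (simp add: word_simps)
  then show "s \<otimes> t = t \<otimes> s \<otimes> ?m" using M_central[OF m, of "t \<otimes> s"] assms by simp
qed

lemma not_abelian: "\<exists>s\<in>carrier G. \<exists>t\<in>carrier G. s \<otimes> t \<noteq> t \<otimes> s"
proof -
  obtain a b where "a \<in> A" "a \<noteq> \<one>" "b \<in> B" "b \<noteq> \<one>"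
    using A_obtain B_obtain by metis
  then show ?thesis using not_commute car by blast
qed

text \<open>For a fixed nontrivial \<open>b\<close> in \<open>B\<close>, sending \<open>x\<close> to
  its commutator with \<open>b\<close> is a homomorphism from \<open>A\<close> to \<open>M\<close>
  because these commutators are central. By \<open>not_commute\<close> it is injective, and its
  nontrivial image is \<open>M\<close> by \<open>minM\<close>.\<close>

lemma card_A_eq_card_M: "card A = card M"
proof -
  obtain b where b: "b \<in> B" "b \<noteq> \<one>" by (rule B_obtain)
  define f where "f x = x \<otimes> b \<otimes> inv x \<otimes> inv b" for x
  have bc: "b \<in> carrier G" using b car by blast
  have fM: "f x \<in> M" if "x \<in> A" for x using that commutator_AB b by (simp add: f_def)
  have fmult: "f (x \<otimes> y) = f x \<otimes> f y" if xy: "x \<in> A" "y \<in> A" for x y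
  proof -
    have c: "x \<in> carrier G" "y \<in> carrier G" using xy car by auto
    have "f (x \<otimes> y) = x \<otimes> f y \<otimes> (b \<otimes> inv x \<otimes> inv b)"
      using c bc by (simp add: f_def word_simps)
    also have "\<dots> = f y \<otimes> x \<otimes> (b \<otimes> inv x \<otimes> inv b)"
      using M_central[OF fM[OF xy(2)], of x] c by simp
    also have "\<dots> = f y \<otimes> f x" using c bc by (simp add: f_def word_simps)
    also have "\<dots> = f x \<otimes> f y" using M_central[OF fM[OF xy(2)], of "f x"] fM xy car by simp
    finally show ?thesis .
  qed
  have f1: "f \<one> = \<one>" using bc by (simp add: f_def)
  have sg: "subgroup (f ` A) G"
  proof (rule subgroupI)
    show "f ` A \<subseteq> carrier G" using fM car by blast
    show "f ` A \<noteq> {}" using subgroup.one_closed[OF sgA] by blast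
  next
    fix u assume "u \<in> f ` A"
    then obtain x where x: "x \<in> A" "u = f x" by blast
    have ix: "inv x \<in> A" using x sgA by (simp add: subgroup.m_inv_closed)
    have "f (inv x) \<otimes> f x = \<one>"
      using fmult[OF ix x(1)] f1 x car by simp
    then have "inv u = f (inv x)" using x ix fM car inv_equality by metis
    then show "inv u \<in> f ` A" using ix by blast
  next
    fix u v assume "u \<in> f ` A" "v \<in> f ` A"
    then show "u \<otimes> v \<in> f ` A"
      using fmult subgroup.m_closed[OF sgA] by (auto simp flip: fmult)
  qed
  have ker: "x = \<one>" if x: "x \<in> A" "f x = \<one>" for x
  proof (rule ccontr)
    assume "x \<noteq> \<one>"
    moreover have "x \<otimes> b = f x \<otimes> (b \<otimes> x)" using x(1) car bc by (simp add: f_def word_simps)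
    ultimately show False using not_commute[OF x(1) b(1)] b x car bc by simp
  qed
  have "inj_on f A"
  proof (rule inj_onI)
    fix x y assume xy: "x \<in> A" "y \<in> A" "f x = f y"
    have iy: "inv y \<in> A" using xy sgA by (simp add: subgroup.m_inv_closed)
    have "f (x \<otimes> inv y) = f (y \<otimes> inv y)" using fmult xy iy by simp
    also have "\<dots> = \<one>" using f1 xy car by simp
    finally have "x \<otimes> inv y = \<one>" using ker subgroup.m_closed[OF sgA] xy iy by blast
    then show "x = y" using xy car by (metis inv_closed inv_inv inv_equality)
  qed
  moreover have "f ` A = M"
  proof -
    obtain a where a: "a \<in> A" "a \<noteq> \<one>" by (rule A_obtain)
    have "f a \<noteq> \<one>" using ker a by blast
    then show ?thesis using minM[OF sg] fM a by blast
  qed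
  ultimately show ?thesis using card_image by metis
qed

lemma card_B_eq_card_M: "card B = card M"
  using minimal_triple.card_A_eq_card_M[OF swap] .

lemma card_M_ge_2: "card M \<ge> 2"
proof -
  obtain z where z: "z \<in> M" "z \<noteq> \<one>"
    using M_nontrivial subgroup.one_closed[OF sgM] by blast
  have "finite M" by (rule finite_subset[OF subgroup.subset[OF sgM] fin])
  then have "card {\<one>, z} \<le> card M"
    using z subgroup.one_closed[OF sgM] by (intro card_mono) auto
  then show ?thesis using z by simp
qed

section \<open>Subgroups containing \<open>M\<close>\<close>

lemma mult_M_mem_iff:
  assumes T: "subgroup T G" "M \<subseteq> T" and "u \<in> carrier G" "m \<in> M"
  shows "u \<otimes> m \<in> T \<longleftrightarrow> u \<in> T"
proof
  assume "u \<otimes> m \<in> T"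
  moreover have "inv m \<in> T" using assms by (meson subgroup.m_inv_closed subsetD)
  ultimately have "u \<otimes> m \<otimes> inv m \<in> T" using T by (simp add: subgroup.m_closed)
  then show "u \<in> T" using assms car by (simp add: word_simps)
next
  assume "u \<in> T"
  then show "u \<otimes> m \<in> T" using assms by (meson subgroup.m_closed subsetD)
qed

lemma subgroup_mult_M: "subgroup H G \<Longrightarrow> subgroup (H <#> M) G"
  by (rule subgroup_mult_central[OF _ sgM M_central])

lemma M_subset_mult: "subgroup H G \<Longrightarrow> M \<subseteq> H <#> M"
  by (auto intro: set_mult_memI2[OF _ sgM])

lemma subset_mult_M: "subgroup H G \<Longrightarrow> H \<subseteq> H <#> M"
  by (auto intro: set_mult_memI1[OF _ sgM])

text \<open>Modulo \<open>M\<close> the subgroups \<open>A\<close> and \<open>B\<close> commute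
  elementwise, so the \<open>A\<close>-components of products lying in \<open>T\<close> form a
  subgroup of \<open>A\<close>. It contains \<open>x0\<close> and hence is all of \<open>A\<close>
  by minimality.\<close>

lemma projection_A:
  assumes T: "subgroup T G" "M \<subseteq> T" and x0: "x0 \<in> A" "x0 \<noteq> \<one>" "y0 \<in> B" "x0 \<otimes> y0 \<in> T"
    and x: "x \<in> A"
  shows "\<exists>y\<in>B. x \<otimes> y \<in> T"
proof -
  let ?P = "{x \<in> A. \<exists>y\<in>B. x \<otimes> y \<in> T}"
  have "subgroup ?P G"
  proof (rule subgroupI)
    show "?P \<subseteq> carrier G" using car by auto
    show "?P \<noteq> {}" using x0 by auto
  next
    fix u assume "u \<in> ?P"
    then obtain y where u: "u \<in> A" "y \<in> B" "u \<otimes> y \<in> T" by blast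
    then have c: "u \<in> carrier G" "y \<in> carrier G" using car by auto
    obtain m where m: "m \<in> M" "inv u \<otimes> inv y = inv y \<otimes> inv u \<otimes> m"
      by (rule commute_mod[OF inv_closed[OF c(1)] inv_closed[OF c(2)]])
    have "inv y \<otimes> inv u \<in> T"
      using subgroup.m_inv_closed[OF T(1) u(3)] c by (simp add: inv_mult_group)
    then have "inv u \<otimes> inv y \<in> T"
      using mult_M_mem_iff[OF T _ m(1), of "inv y \<otimes> inv u"] m c by simp
    then show "inv u \<in> ?P"
      using u sgA sgB by (auto simp: subgroup.m_inv_closed)
  next
    fix u u' assume "u \<in> ?P" "u' \<in> ?P"
    then obtain y y' where u: "u \<in> A" "y \<in> B" "u \<otimes> y \<in> T" "u' \<in> A" "y' \<in> B" "u' \<otimes> y' \<in> T" by blast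
    then have c: "u \<in> carrier G" "y \<in> carrier G" "u' \<in> carrier G" "y' \<in> carrier G" using car by auto
    obtain m where m: "m \<in> M" "u' \<otimes> y = y \<otimes> u' \<otimes> m"
      by (rule commute_mod[OF c(3) c(2)])
    have mc: "m \<in> carrier G" using m car by blast
    have "(u \<otimes> u') \<otimes> (y \<otimes> y') = u \<otimes> (u' \<otimes> y) \<otimes> y'" using c by (simp add: m_assoc)
    also have "\<dots> = u \<otimes> y \<otimes> u' \<otimes> (m \<otimes> y')" using m c mc by (simp add: m_assoc)
    also have "m \<otimes> y' = y' \<otimes> m" using M_central m c by blast
    also have "u \<otimes> y \<otimes> u' \<otimes> (y' \<otimes> m) = (u \<otimes> y) \<otimes> (u' \<otimes> y') \<otimes> m" using c mc by (simp add: m_assoc)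
    finally have "(u \<otimes> u') \<otimes> (y \<otimes> y') \<in> T"
      using T u m by (auto intro!: subgroup.m_closed)
    then show "u \<otimes> u' \<in> ?P" using u sgA sgB by (auto intro: subgroup.m_closed)
  qed
  then have "?P = A" using minA[of ?P] x0 by blast
  then show ?thesis using x by blast
qed

text \<open>By \<open>projection_A\<close>, \<open>T\<close> contains an element with any prescribed
  \<open>A\<close>-component. An element of \<open>T'\<close> with the same
  \<open>A\<close>-component differs from it, up to \<open>M\<close>, by an element of
  \<open>T' \<inter> B\<close>, which is trivial.\<close>

lemma eq_if_trivial_on_B:
  assumes T: "subgroup T G" "M \<subseteq> T" "T \<noteq> M" and T': "subgroup T' G" "T \<subseteq> T'" "T' \<inter> B = {\<one>}"
  shows "T = T'"
proof
  obtain t where t: "t \<in> T" "t \<notin> M" using T by blast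
  obtain x y m where xym: "x \<in> A" "y \<in> B" "m \<in> M" "t = x \<otimes> y \<otimes> m"
    by (rule decompE[OF subgroup.mem_carrier[OF T(1) t(1)]])
  have xy: "x \<otimes> y \<in> T" using mult_M_mem_iff[OF T(1,2)] xym t car by simp
  have x1: "x \<noteq> \<one>"
  proof
    assume "x = \<one>"
    then have "y \<in> T' \<inter> B" using xy T' xym car by auto
    then have "t = m" using T' xym \<open>x = \<one>\<close> car by auto
    then show False using t xym by simp
  qed
  show "T' \<subseteq> T"
  proof
    fix t' assume t': "t' \<in> T'"
    obtain x' y' m' where 1: "x' \<in> A" "y' \<in> B" "m' \<in> M" "t' = x' \<otimes> y' \<otimes> m'"
      by (rule decompE[OF subgroup.mem_carrier[OF T'(1) t']])
    obtain y'' where 2: "y'' \<in> B" "x' \<otimes> y'' \<in> T"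
      using projection_A[OF T(1,2) xym(1) x1 xym(2) xy 1(1)] by blast
    have c: "x' \<in> carrier G" "y' \<in> carrier G" "m' \<in> carrier G" "y'' \<in> carrier G"
      using 1 2 car by auto
    have "x' \<otimes> y' \<in> T'" using mult_M_mem_iff[of T'] T T' 1 t' c by auto
    then have "inv (x' \<otimes> y'') \<otimes> (x' \<otimes> y') \<in> T'"
      using 2 T' by (meson subgroup.m_closed subgroup.m_inv_closed subsetD)
    also have "inv (x' \<otimes> y'') \<otimes> (x' \<otimes> y') = inv y'' \<otimes> y'" using c by (simp add: word_simps)
    finally have "inv y'' \<otimes> y' \<in> T' \<inter> B"
      using 1 2 sgB by (simp add: subgroup.m_closed subgroup.m_inv_closed)
    then have "inv y'' \<otimes> y' = \<one>" using T' by blast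
    then have "y' = y''" using c by (metis inv_inv inv_closed inv_equality)
    then show "t' \<in> T" using 1 2 T c by (metis mult_M_mem_iff m_closed)
  qed
qed (fact T')

text \<open>\<open>T\<close> contains \<open>B\<close> by minimality. If it also meets
  \<open>A\<close> nontrivially, it contains all three factors. Otherwise removing the factors from
  \<open>B\<close> and \<open>M\<close> leaves an \<open>A\<close>-component in
  \<open>T \<inter> A\<close>, which is trivial.\<close>

lemma overgroup_meeting_B:
  assumes T: "subgroup T G" "M \<subseteq> T" "T \<inter> B \<noteq> {\<one>}"
  shows "T = B <#> M \<or> T = carrier G"
proof (cases "T \<inter> A = {\<one>}")
  case False
  then have "A \<subseteq> T" "B \<subseteq> T"
    using minA[of "T \<inter> A"] minB[of "T \<inter> B"] T sgA sgB subgroups_Inter_pair by blast+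
  then show ?thesis using covers T by blast
next
  case True
  have BT: "B \<subseteq> T" using minB[of "T \<inter> B"] T sgB subgroups_Inter_pair by blast
  have "T \<subseteq> B <#> M"
  proof
    fix t assume t: "t \<in> T"
    obtain x y m where xym: "x \<in> A" "y \<in> B" "m \<in> M" "t = x \<otimes> y \<otimes> m"
      by (rule decompE[OF subgroup.mem_carrier[OF T(1) t]])
    have c: "x \<in> carrier G" "y \<in> carrier G" "m \<in> carrier G" using xym car by auto
    have "x \<otimes> y \<in> T" using mult_M_mem_iff[OF T(1,2)] xym t c by simp
    then have "x \<otimes> y \<otimes> inv y \<in> T" using BT xym T(1) by (meson subgroup.m_closed subgroup.m_inv_closed subsetD)
    then have "x \<in> T \<inter> A" using c xym by (simp add: word_simps)
    then have "t = y \<otimes> m" using True xym c by simp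
    then show "t \<in> B <#> M" using xym by (simp add: set_multI)
  qed
  then show ?thesis using set_mult_subset_subgroup[OF T(1) BT T(2)] by blast
qed

text \<open>The subgroups strictly between \<open>M\<close> and \<open>G\<close> form an antichain:
  they correspond to the subgroups of order p in a quotient of order p^2. The proof compares them by
  their intersections with \<open>B\<close>.\<close>

lemma overgroups_chain:
  assumes T: "subgroup T G" "M \<subseteq> T" "T \<noteq> M"
    and T': "subgroup T' G" "T \<subseteq> T'" "T' \<noteq> carrier G"
  shows "T = T'"
proof (cases "T' \<inter> B = {\<one>}")
  case True
  then show ?thesis using eq_if_trivial_on_B assms by blast
next
  case False
  then have T'B: "T' = B <#> M" using overgroup_meeting_B[of T'] T T' by blast
  have "T \<inter> B \<noteq> {\<one>}"
  proof
    assume TB: "T \<inter> B = {\<one>}"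
    obtain t where t: "t \<in> T" "t \<notin> M" using T by blast
    then obtain y m where ym: "y \<in> B" "m \<in> M" "t = y \<otimes> m" using T' T'B by (blast elim: set_multE)
    then have "y \<in> T" using mult_M_mem_iff[OF T(1,2)] t car by simp
    then have "y = \<one>" using TB ym by blast
    then show False using t ym car by simp
  qed
  then have "T = B <#> M \<or> T = carrier G" using overgroup_meeting_B T by blast
  then show ?thesis using T'B T' subgroup.subset[OF T'(1)] by blast
qed

section \<open>Subgroups that avoid \<open>M\<close>\<close>

lemma avoiding_commute:
  assumes U: "U \<in> avoiding G M" and "x \<in> U" "y \<in> U"
  shows "x \<otimes> y = y \<otimes> x"
proof -
  have sg: "subgroup U G" and XM: "U \<inter> M = {\<one>}" using U by (auto simp: avoiding_def)
  have c: "x \<in> carrier G" "y \<in> carrier G" using assms sg by (auto intro: subgroup.mem_carrier)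
  have "x \<otimes> y \<otimes> inv x \<otimes> inv y \<in> U \<inter> M"
    using commutator_in_M[OF c] assms(2,3) sg by (simp add: subgroup.m_closed subgroup.m_inv_closed)
  then have "x \<otimes> y \<otimes> inv x \<otimes> inv y = \<one>" using XM by blast
  moreover have "x \<otimes> y = (x \<otimes> y \<otimes> inv x \<otimes> inv y) \<otimes> (y \<otimes> x)" using c by (simp add: word_simps)
  ultimately show ?thesis using c by simp
qed

text \<open>An avoiding subgroup is abelian by \<open>avoiding_commute\<close> and \<open>M\<close>
  is central, so \<open>U <#> M = carrier G\<close> would make \<open>G\<close> abelian.\<close>

lemma avoiding_mult_M:
  assumes U: "U \<in> avoiding G M"
  shows "U <#> M \<noteq> M" "U <#> M \<noteq> carrier G"
proof -
  have sg: "subgroup U G" and X1: "U \<noteq> {\<one>}" and XM: "U \<inter> M = {\<one>}"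
    using U by (auto simp: avoiding_def)
  show "U <#> M \<noteq> M" using subset_mult_M[OF sg] X1 XM by blast
  show "U <#> M \<noteq> carrier G"
  proof
    assume cov: "U <#> M = carrier G"
    have "s \<otimes> t = t \<otimes> s" if "s \<in> carrier G" "t \<in> carrier G" for s t
    proof (rule commute_if_product[OF sg sgM _ avoiding_commute[OF U] _ _ that])
      show "carrier G \<subseteq> U <#> M" by (simp add: cov)
      show "x \<otimes> y = y \<otimes> x" if "x \<in> M" "y \<in> M" for x y
        by (rule M_central[OF that(1) M_carrier[OF that(2)]])
      show "x \<otimes> y = y \<otimes> x" if "x \<in> U" "y \<in> M" for x y
        using M_central[of y x] that subgroup.mem_carrier[OF sg] by simp
    qed
    then show False using not_abelian by blast
  qed
qed

text \<open>By \<open>overgroups_chain\<close> the products of \<open>U\<close> and \<open>V\<close>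
  with \<open>M\<close> agree, and an element \<open>y \<otimes> m\<close> of \<open>U\<close> with
  \<open>y\<close> in \<open>V\<close> has \<open>m\<close> in \<open>U \<inter> M\<close>.\<close>

lemma avoiding_minimal:
  assumes U: "U \<in> avoiding G M" and V: "subgroup V G" "V \<subseteq> U" "V \<noteq> {\<one>}"
  shows "V = U"
proof -
  have sg: "subgroup U G" and XM: "U \<inter> M = {\<one>}" using U by (auto simp: avoiding_def)
  have YM: "V \<inter> M = {\<one>}" using XM V subgroup.one_closed[OF V(1)] by blast
  have Y_av: "V \<in> avoiding G M" using V YM by (simp add: avoiding_def)
  have "V <#> M = U <#> M"
    using overgroups_chain[OF subgroup_mult_M[OF V(1)] M_subset_mult[OF V(1)] avoiding_mult_M(1)[OF Y_av]
        subgroup_mult_M[OF sg] mono_set_mult[OF V(2) subset_refl] avoiding_mult_M(2)[OF U]] .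
  have "U \<subseteq> V"
  proof
    fix x assume x: "x \<in> U"
    then have "x \<in> V <#> M" using subset_mult_M[OF sg] \<open>V <#> M = U <#> M\<close> by blast
    then obtain y m where ym: "y \<in> V" "m \<in> M" "x = y \<otimes> m" by (rule set_multE)
    have c: "y \<in> carrier G" "m \<in> carrier G" using ym V(1) car by (auto intro: subgroup.mem_carrier)
    have "m = inv y \<otimes> x" using ym c by (simp add: word_simps)
    then have "m \<in> U \<inter> M"
      using x ym V(2) sg by (metis IntI subgroup.m_closed subgroup.m_inv_closed subsetD)
    then show "x \<in> V" using XM ym c by auto
  qed
  with V show ?thesis by blast
qed

text \<open>If \<open>U\<close> and \<open>V\<close> commuted, the subgroup \<open>U <#> V\<close>
  would meet \<open>M\<close> trivially or contain it. In the first case it avoids \<open>M\<close>,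
  and minimality gives \<open>U = ?T = V\<close>. In the second, \<open>overgroups_chain\<close>
  gives \<open>U <#> M = ?T = V <#> M\<close>, unless \<open>?T\<close> is all of
  \<open>G\<close>.\<close>

lemma avoiding_not_commute:
  assumes U: "U \<in> avoiding G M" and V: "V \<in> avoiding G M" and ne: "U <#> M \<noteq> V <#> M"
  shows "U <#> V \<noteq> V <#> U"
proof
  assume XY: "U <#> V = V <#> U"
  have sX: "subgroup U G" and XM: "U \<inter> M = {\<one>}" using U by (auto simp: avoiding_def)
  have sY: "subgroup V G" and YM: "V \<inter> M = {\<one>}" using V by (auto simp: avoiding_def)
  let ?T = "U <#> V"
  have sT: "subgroup ?T G" by (rule subgroup_set_mult[OF sX sY XY])
  have XT: "U \<subseteq> ?T" and YT: "V \<subseteq> ?T"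
    using set_mult_memI1[OF sX sY] set_mult_memI2[OF sX sY] by blast+
  have "?T \<inter> M = {\<one>} \<or> ?T \<inter> M = M"
    using minM[of "?T \<inter> M"] subgroups_Inter_pair[OF sT sgM] by blast
  then show False
  proof
    assume "?T \<inter> M = {\<one>}"
    moreover have U1: "U \<noteq> {\<one>}" and V1: "V \<noteq> {\<one>}" using U V by (auto simp: avoiding_def)
    moreover have "?T \<noteq> {\<one>}" using XT U1 subgroup.one_closed[OF sX] by blast
    ultimately have T: "?T \<in> avoiding G M" using sT by (simp add: avoiding_def)
    have "U = ?T" "V = ?T"
      using avoiding_minimal[OF T sX XT U1] avoiding_minimal[OF T sY YT V1] by blast+
    then show False using ne by simp
  next
    assume "?T \<inter> M = M"
    then have MT: "M \<subseteq> ?T" by blast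
    show False
    proof (cases "?T = carrier G")
      case False
      have "U <#> M = ?T"
        using overgroups_chain[OF subgroup_mult_M[OF sX] M_subset_mult[OF sX] avoiding_mult_M(1)[OF U]
          sT set_mult_subset_subgroup[OF sT XT MT] False] .
      moreover have "V <#> M = ?T"
        using overgroups_chain[OF subgroup_mult_M[OF sY] M_subset_mult[OF sY] avoiding_mult_M(1)[OF V]
          sT set_mult_subset_subgroup[OF sT YT MT] False] .
      ultimately show False using ne by simp
    next
      case True
      \<comment> \<open>If \<open>U <#> V\<close> is all of \<open>G\<close>, a nontrivial central
        \<open>z\<close> splits as \<open>x \<otimes> y\<close>. Then \<open>y\<close> is an element
        of the abelian \<open>U\<close> times a central one, so it centralizes \<open>U\<close>. By
        minimality of \<open>V\<close> so does all of \<open>V\<close>, and \<open>G\<close> would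
        be abelian.\<close>
      obtain z where z: "z \<in> M" "z \<noteq> \<one>"
        using M_nontrivial subgroup.one_closed[OF sgM] by blast
      then obtain x y where xy: "x \<in> U" "y \<in> V" "z = x \<otimes> y" using MT by (blast elim: set_multE)
      have c: "x \<in> carrier G" "y \<in> carrier G" "z \<in> carrier G"
        using xy sX sY z car by (auto intro: subgroup.mem_carrier)
      have y: "y = inv x \<otimes> z" using xy c by (simp add: word_simps)
      have y1: "y \<noteq> \<one>"
      proof
        assume "y = \<one>"
        then have "z = x" using xy(3) c by simp
        then show False using xy(1) z XM by blast
      qed
      have yX: "y \<otimes> u = u \<otimes> y" if u: "u \<in> U" for u
      proof -
        have uc: "u \<in> carrier G" using u sX by (auto intro: subgroup.mem_carrier)
        have ix: "inv x \<in> U" using xy sX by (simp add: subgroup.m_inv_closed)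
        have "y \<otimes> u = inv x \<otimes> (z \<otimes> u)" using y c uc by (simp add: m_assoc)
        also have "z \<otimes> u = u \<otimes> z" using M_central z uc by blast
        also have "inv x \<otimes> (u \<otimes> z) = (inv x \<otimes> u) \<otimes> z" using c uc by (simp add: m_assoc)
        also have "inv x \<otimes> u = u \<otimes> inv x" using avoiding_commute[OF U ix u] .
        finally show ?thesis using y c uc by (simp add: m_assoc)
      qed
      let ?C = "{s \<in> carrier G. \<forall>t\<in>U. s \<otimes> t = t \<otimes> s}"
      have "subgroup (V \<inter> ?C) G"
        using subgroups_Inter_pair[OF sY subgroup_centralizer[OF subgroup.subset[OF sX]]] .
      moreover have "y \<in> V \<inter> ?C" using xy c yX by blast
      ultimately have "V \<inter> ?C = V" using avoiding_minimal[OF V, of "V \<inter> ?C"] y1 by blast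
      then have YX: "u \<otimes> v = v \<otimes> u" if "u \<in> U" "v \<in> V" for u v using that by force
      have "s \<otimes> t = t \<otimes> s" if "s \<in> carrier G" "t \<in> carrier G" for s t
        using True by (intro commute_if_product[OF sX sY _ avoiding_commute[OF U] avoiding_commute[OF V] YX that]) auto
      then show False using not_abelian by blast
    qed
  qed
qed

section \<open>Estimates for the number of subgroups and of non-commuting pairs\<close>

lemma finite_subgroups: "finite {H. subgroup H G}"
  by (rule finite_subset[of _ "Pow (carrier G)"]) (auto simp: fin dest: subgroup.subset)

lemma finite_avoiding: "finite (avoiding G M)"
  by (rule finite_subset[OF _ finite_subgroups]) (auto simp: avoiding_def)

lemma finite_M: "finite M"
  by (rule finite_subset[OF subgroup.subset[OF sgM] fin])

text \<open>Fix a nontrivial \<open>x\<close> in \<open>U\<close>. Any \<open>V\<close> in the same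
  fibre contains a nontrivial element \<open>x \<otimes> m\<close> with \<open>m\<close> in
  \<open>M\<close>. By \<open>avoiding_minimal\<close> this element generates \<open>V\<close>, so
  \<open>m\<close> determines \<open>V\<close>.\<close>

lemma card_fibre_le:
  assumes U: "U \<in> avoiding G M"
  shows "card {V \<in> avoiding G M. V <#> M = U <#> M} \<le> card M"
proof -
  have sU: "subgroup U G" and U1: "U \<noteq> {\<one>}" and UM: "U \<inter> M = {\<one>}"
    using U by (auto simp: avoiding_def)
  obtain x where x: "x \<in> U" "x \<noteq> \<one>" using U1 subgroup.one_closed[OF sU] by blast
  have xc: "x \<in> carrier G" by (rule subgroup.mem_carrier[OF sU x(1)])
  have "{V \<in> avoiding G M. V <#> M = U <#> M} \<subseteq> (\<lambda>m. generate G {x \<otimes> m}) ` M"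
  proof
    fix V assume "V \<in> {V \<in> avoiding G M. V <#> M = U <#> M}"
    then have V: "V \<in> avoiding G M" and VU: "V <#> M = U <#> M" by auto
    have sV: "subgroup V G" using V by (auto simp: avoiding_def)
    have "x \<in> V <#> M" using set_mult_memI1[OF sU sgM x(1)] VU by simp
    then obtain v m where vm: "v \<in> V" "m \<in> M" "x = v \<otimes> m" by (rule set_multE)
    have c: "v \<in> carrier G" "m \<in> carrier G"
      by (rule subgroup.mem_carrier[OF sV vm(1)], rule M_carrier[OF vm(2)])
    have v: "v = x \<otimes> inv m" using vm c by (simp add: word_simps)
    have v1: "v \<noteq> \<one>"
    proof
      assume "v = \<one>"
      then have "x = m" using vm(3) c by simp
      then show False using x vm(2) UM by blast
    qed
    have vgen: "v \<in> generate G {v}" by (rule generate.incl) simp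
    have "generate G {v} = V"
    proof (rule avoiding_minimal[OF V])
      show "subgroup (generate G {v}) G" using c by (intro generate_is_subgroup) simp
      show "generate G {v} \<subseteq> V" using vm(1) sV by (intro generate_subgroup_incl) auto
      show "generate G {v} \<noteq> {\<one>}" using vgen v1 by blast
    qed
    moreover have "inv m \<in> M" by (rule subgroup.m_inv_closed[OF sgM vm(2)])
    ultimately show "V \<in> (\<lambda>m. generate G {x \<otimes> m}) ` M" unfolding v by blast
  qed
  then have "card {V \<in> avoiding G M. V <#> M = U <#> M} \<le> card ((\<lambda>m. generate G {x \<otimes> m}) ` M)"
    by (intro card_mono finite_imageI finite_M)
  also have "\<dots> \<le> card M" by (rule card_image_le[OF finite_M])
  finally show ?thesis .
qed

lemma A_avoiding: "A \<in> avoiding G M"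
proof -
  have "A \<inter> M = {\<one>}"
    using A_Int_M subgroup.one_closed[OF sgA] subgroup.one_closed[OF sgM] by blast
  then show ?thesis using sgA A_nontrivial by (simp add: avoiding_def)
qed

lemma conjugate_mod_M:
  assumes "x \<in> carrier G" "y \<in> carrier G"
  obtains m where "m \<in> M" "y \<otimes> x \<otimes> inv y = x \<otimes> m"
proof -
  obtain m where m: "m \<in> M" "y \<otimes> x = x \<otimes> y \<otimes> m" by (rule commute_mod[OF assms(2,1)])
  have mc: "m \<in> carrier G" by (rule M_carrier[OF m(1)])
  have "y \<otimes> x \<otimes> inv y = x \<otimes> y \<otimes> (m \<otimes> inv y)" using m assms mc by (simp add: m_assoc)
  also have "m \<otimes> inv y = inv y \<otimes> m" using M_central[OF m(1), of "inv y"] assms(2) by simp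
  also have "x \<otimes> y \<otimes> (inv y \<otimes> m) = x \<otimes> m" using assms mc by (simp add: word_simps)
  finally show thesis using that m(1) by blast
qed

text \<open>Conjugation changes an element only by a factor in \<open>M\<close>, so a conjugate of
  \<open>A\<close> stays inside \<open>A <#> M\<close>. As it avoids \<open>M\<close> too,
  \<open>overgroups_chain\<close> turns the inclusion of the products with \<open>M\<close> into
  equality.\<close>

lemma conjugate_A_avoiding:
  assumes y: "y \<in> B"
  shows "(\<lambda>x. y \<otimes> x \<otimes> inv y) ` A \<in> avoiding G M"
    and "(\<lambda>x. y \<otimes> x \<otimes> inv y) ` A <#> M = A <#> M"
proof -
  let ?U = "(\<lambda>x. y \<otimes> x \<otimes> inv y) ` A"
  have yc: "y \<in> carrier G" by (rule B_carrier[OF y])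
  have sg: "subgroup ?U G"
  proof (rule subgroupI)
    show "?U \<subseteq> carrier G" using yc car by auto
    show "?U \<noteq> {}" using subgroup.one_closed[OF sgA] by blast
  next
    fix u assume "u \<in> ?U"
    then obtain x where x: "x \<in> A" "u = y \<otimes> x \<otimes> inv y" by blast
    have "inv u = y \<otimes> inv x \<otimes> inv y" using x yc car by (simp add: word_simps)
    then show "inv u \<in> ?U" using x subgroup.m_inv_closed[OF sgA] by blast
  next
    fix u v assume "u \<in> ?U" "v \<in> ?U"
    then obtain x x' where x: "x \<in> A" "u = y \<otimes> x \<otimes> inv y" "x' \<in> A" "v = y \<otimes> x' \<otimes> inv y" by blast
    have "u \<otimes> v = y \<otimes> (x \<otimes> x') \<otimes> inv y" using x yc car by (simp add: word_simps)
    then show "u \<otimes> v \<in> ?U" using x subgroup.m_closed[OF sgA] by blast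
  qed
  have sub: "?U \<subseteq> A <#> M"
  proof
    fix u assume "u \<in> ?U"
    then obtain x where x: "x \<in> A" "u = y \<otimes> x \<otimes> inv y" by blast
    obtain m where "m \<in> M" "y \<otimes> x \<otimes> inv y = x \<otimes> m"
      by (rule conjugate_mod_M[OF A_carrier[OF x(1)] yc])
    then show "u \<in> A <#> M" using x by (simp add: set_multI)
  qed
  have one: "x = \<one>" if x: "x \<in> A" "y \<otimes> x \<otimes> inv y \<in> M" for x
  proof -
    obtain m where m: "m \<in> M" "y \<otimes> x \<otimes> inv y = x \<otimes> m"
      by (rule conjugate_mod_M[OF A_carrier[OF x(1)] yc])
    then have "x \<in> M" using mult_M_mem_iff[OF sgM subset_refl A_carrier[OF x(1)] m(1)] x by simp
    then show ?thesis using A_Int_M x by blast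
  qed
  have int: "?U \<inter> M = {\<one>}"
  proof
    show "{\<one>} \<subseteq> ?U \<inter> M" using subgroup.one_closed[OF sg] subgroup.one_closed[OF sgM] by blast
    show "?U \<inter> M \<subseteq> {\<one>}"
    proof clarify
      fix x assume x: "x \<in> A" "y \<otimes> x \<otimes> inv y \<in> M"
      then show "y \<otimes> x \<otimes> inv y = \<one>" using one[OF x] yc by simp
    qed
  qed
  moreover have "?U \<noteq> {\<one>}"
  proof
    assume U: "?U = {\<one>}"
    obtain a where a: "a \<in> A" "a \<noteq> \<one>" by (rule A_obtain)
    then have "y \<otimes> a \<otimes> inv y = \<one>" using U by blast
    then have "y \<otimes> a \<otimes> inv y \<in> M" using subgroup.one_closed[OF sgM] by simp
    then show False using one a by blast
  qed
  ultimately show av: "?U \<in> avoiding G M" using sg by (simp add: avoiding_def)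
  show "?U <#> M = A <#> M"
  proof (rule overgroups_chain[OF subgroup_mult_M[OF sg] M_subset_mult[OF sg] avoiding_mult_M(1)[OF av]
        subgroup_mult_M[OF sgA] _ avoiding_mult_M(2)[OF A_avoiding]])
    show "?U <#> M \<subseteq> A <#> M"
      by (rule set_mult_subset_subgroup[OF subgroup_mult_M[OF sgA] sub M_subset_mult[OF sgA]])
  qed
qed

text \<open>The conjugates of \<open>A\<close> by the elements of \<open>B\<close> lie in this fibre
  and are distinct, and \<open>card B = card M\<close>.\<close>

lemma card_fibre_A_ge: "card {V \<in> avoiding G M. V <#> M = A <#> M} \<ge> card M"
proof -
  let ?f = "\<lambda>y. (\<lambda>x. y \<otimes> x \<otimes> inv y) ` A"
  obtain a where a: "a \<in> A" "a \<noteq> \<one>" by (rule A_obtain)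
  have ac: "a \<in> carrier G" by (rule A_carrier[OF a(1)])
  have "inj_on ?f B"
  proof (rule inj_onI)
    fix y y' assume y: "y \<in> B" "y' \<in> B" and eq: "?f y = ?f y'"
    have yc: "y \<in> carrier G" "y' \<in> carrier G" using y car by auto
    have "y \<otimes> a \<otimes> inv y \<in> ?f y'" using a eq by blast
    then obtain a' where a': "a' \<in> A" "y \<otimes> a \<otimes> inv y = y' \<otimes> a' \<otimes> inv y'" by blast
    have a'c: "a' \<in> carrier G" by (rule A_carrier[OF a'(1)])
    obtain m where m: "m \<in> M" "y \<otimes> a \<otimes> inv y = a \<otimes> m" by (rule conjugate_mod_M[OF ac yc(1)])
    obtain m' where m': "m' \<in> M" "y' \<otimes> a' \<otimes> inv y' = a' \<otimes> m'" by (rule conjugate_mod_M[OF a'c yc(2)])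
    have mc: "m \<in> carrier G" "m' \<in> carrier G" using m m' car by auto
    \<comment> \<open>Equality of the conjugate subgroups does not yet match elements. Modulo
      \<open>M\<close> the elements \<open>a\<close> and \<open>a'\<close> agree, so they are equal
      because \<open>A \<inter> M\<close> is trivial. Then \<open>inv y' \<otimes> y\<close>
      commutes with \<open>a\<close> and is trivial by \<open>not_commute\<close>.\<close>
    have "a \<otimes> m = a' \<otimes> m'" using a' m m' by simp
    then have "inv a' \<otimes> (a \<otimes> m) = m'" using a'c mc by (simp add: word_simps)
    then have "(inv a' \<otimes> a) \<otimes> m \<in> M" using m' ac a'c mc by (simp add: m_assoc)
    then have "inv a' \<otimes> a \<in> M"
      using mult_M_mem_iff[OF sgM subset_refl _ m(1), of "inv a' \<otimes> a"] ac a'c by simp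
    moreover have "inv a' \<otimes> a \<in> A"
      using a(1) a'(1) sgA by (simp add: subgroup.m_closed subgroup.m_inv_closed)
    ultimately have "inv a' \<otimes> a = \<one>" using A_Int_M by blast
    then have "a' = a" using ac a'c by (metis inv_closed inv_equality inv_inv)
    then have e: "y \<otimes> a \<otimes> inv y = y' \<otimes> a \<otimes> inv y'" using a' by simp
    let ?w = "inv y' \<otimes> y"
    have wB: "?w \<in> B" using y sgB by (simp add: subgroup.m_closed subgroup.m_inv_closed)
    have "?w \<otimes> a = inv y' \<otimes> (y \<otimes> a \<otimes> inv y) \<otimes> y" using yc ac by (simp add: word_simps)
    also have "\<dots> = a \<otimes> ?w" unfolding e using yc ac by (simp add: word_simps)
    finally have "?w = \<one>" using not_commute[OF a(1) wB a(2)] by metis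
    then show "y = y'" using yc by (metis inv_closed inv_equality inv_inv)
  qed
  then have "card B = card (?f ` B)" by (simp add: card_image)
  also have "\<dots> \<le> card {V \<in> avoiding G M. V <#> M = A <#> M}"
    using finite_avoiding conjugate_A_avoiding by (intro card_mono) auto
  finally show ?thesis by (simp add: card_B_eq_card_M)
qed

lemma A_mult_M_neq_B_mult_M: "A <#> M \<noteq> B <#> M"
proof
  assume eq: "A <#> M = B <#> M"
  have "A <#> M = carrier G"
    using subset_mult_M[OF sgA] subset_mult_M[OF sgB] M_subset_mult[OF sgA] eq
    by (intro covers subgroup_mult_M sgA) auto
  then show False using avoiding_mult_M(2)[OF A_avoiding] by blast
qed

lemma card_avoiding_ge: "card (avoiding G M) \<ge> 2 * card M"
proof -
  let ?FA = "{V \<in> avoiding G M. V <#> M = A <#> M}" and ?FB = "{V \<in> avoiding G M. V <#> M = B <#> M}"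
  have "2 * card M \<le> card ?FA + card ?FB"
    using card_fibre_A_ge minimal_triple.card_fibre_A_ge[OF swap] by simp
  also have "\<dots> = card (?FA \<union> ?FB)"
    using A_mult_M_neq_B_mult_M finite_avoiding by (intro card_Un_disjoint[symmetric]) auto
  also have "\<dots> \<le> card (avoiding G M)"
    by (rule card_mono[OF finite_avoiding]) auto
  finally show ?thesis .
qed

text \<open>Besides \<open>M\<close>, \<open>B <#> M\<close> and \<open>carrier G\<close> there are
  the overgroups in \<open>?W\<close>. Each contains \<open>a \<otimes> y\<close> for the fixed
  \<open>a\<close> and some \<open>y\<close> in \<open>B\<close>, and \<open>y\<close> determines
  it, so there are at most \<open>card B = card M\<close> of them.\<close>

lemma card_overgroups_le: "card {T. subgroup T G \<and> M \<subseteq> T} \<le> card M + 3"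
proof -
  let ?W = "{T. subgroup T G \<and> M \<subseteq> T \<and> T \<noteq> M \<and> T \<inter> B = {\<one>}}"
  obtain a where a: "a \<in> A" "a \<noteq> \<one>" by (rule A_obtain)
  define g where "g T = (SOME y. y \<in> B \<and> a \<otimes> y \<in> T)" for T
  have g: "g T \<in> B \<and> a \<otimes> g T \<in> T" if "T \<in> ?W" for T
  proof -
    have T: "subgroup T G" "M \<subseteq> T" "T \<noteq> M" "T \<inter> B = {\<one>}" using that by auto
    obtain t where t: "t \<in> T" "t \<notin> M" using T by blast
    obtain x y m where xym: "x \<in> A" "y \<in> B" "m \<in> M" "t = x \<otimes> y \<otimes> m"
      by (rule decompE[OF subgroup.mem_carrier[OF T(1) t(1)]])
    have c: "x \<in> carrier G" "y \<in> carrier G" "m \<in> carrier G" using xym car by auto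
    have xy: "x \<otimes> y \<in> T" using mult_M_mem_iff[OF T(1,2) _ xym(3), of "x \<otimes> y"] xym t c by simp
    have x1: "x \<noteq> \<one>"
    proof
      assume x: "x = \<one>"
      then have "y \<in> T \<inter> B" using xy xym c by simp
      then have "y = \<one>" using T(4) by blast
      then have "t = m" using xym(4) x c by simp
      then show False using t xym(3) by simp
    qed
    have "\<exists>y. y \<in> B \<and> a \<otimes> y \<in> T"
      using projection_A[OF T(1,2) xym(1) x1 xym(2) xy a(1)] by blast
    then show ?thesis unfolding g_def by (rule someI_ex)
  qed
  have "inj_on g ?W"
  proof (rule inj_onI)
    fix T T' assume T: "T \<in> ?W" and T': "T' \<in> ?W" and eq: "g T = g T'"
    let ?y = "g T"
    have y: "?y \<in> B" "a \<otimes> ?y \<in> T \<inter> T'" using g[OF T] g[OF T'] eq by auto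
    have c: "a \<in> carrier G" "?y \<in> carrier G" using a y car by auto
    \<comment> \<open>This makes \<open>T \<inter> T'\<close> larger than \<open>M\<close>, so that
      \<open>eq_if_trivial_on_B\<close> identifies it with both \<open>T\<close> and
      \<open>T'\<close>. If \<open>a \<otimes> ?y\<close> were in \<open>M\<close>, it would be
      central, so \<open>?y\<close> would commute with \<open>a\<close> and be trivial, and
      \<open>a\<close> would lie in \<open>M\<close>.\<close>
    have "a \<otimes> ?y \<notin> M"
    proof
      assume "a \<otimes> ?y \<in> M"
      then have "(a \<otimes> ?y) \<otimes> a = a \<otimes> (a \<otimes> ?y)" using M_central c by blast
      then have "a \<otimes> (?y \<otimes> a) = a \<otimes> (a \<otimes> ?y)" using c by (simp add: m_assoc)
      then have "a \<otimes> ?y = ?y \<otimes> a" using c by simp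
      then have "?y = \<one>" using not_commute[OF a(1) y(1) a(2)] by blast
      then show False using \<open>a \<otimes> ?y \<in> M\<close> A_Int_M a c by simp
    qed
    then have ne: "T \<inter> T' \<noteq> M" using y by blast
    have sg: "subgroup (T \<inter> T') G" using T T' by (auto intro: subgroups_Inter_pair)
    have "T \<inter> T' = T" using T T' by (intro eq_if_trivial_on_B[OF sg _ ne]) auto
    moreover have "T \<inter> T' = T'" using T T' by (intro eq_if_trivial_on_B[OF sg _ ne]) auto
    ultimately show "T = T'" by blast
  qed
  moreover have "finite B" by (rule finite_subset[OF subgroup.subset[OF sgB] fin])
  ultimately have W: "card ?W \<le> card B" using g by (intro card_inj_on_le[of g]) auto
  have "{T. subgroup T G \<and> M \<subseteq> T} \<subseteq> {M, B <#> M, carrier G} \<union> ?W"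
    using overgroup_meeting_B by blast
  moreover have "finite ?W" by (rule finite_subset[OF _ finite_subgroups]) auto
  ultimately have "card {T. subgroup T G \<and> M \<subseteq> T} \<le> card ({M, B <#> M, carrier G} \<union> ?W)"
    by (intro card_mono) auto
  also have "\<dots> \<le> card {M, B <#> M, carrier G} + card ?W" by (rule card_Un_le)
  also have "\<dots> \<le> 3 + card B"
    using W card_insert_le_m1[of 3 "{B <#> M, carrier G}" M] card_insert_le_m1[of 2 "{carrier G}" "B <#> M"]
    by simp
  finally show ?thesis by (simp add: card_B_eq_card_M)
qed

text \<open>By \<open>minM\<close> a subgroup is trivial, avoids \<open>M\<close> or contains
  \<open>M\<close>. The constant 4 is the trivial subgroup plus the 3 from
  \<open>card_overgroups_le\<close>.\<close>

lemma card_subgroups_le: "card (subgroups G) \<le> card (avoiding G M) + card M + 4"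
proof -
  let ?O = "{T. subgroup T G \<and> M \<subseteq> T}"
  have "subgroups G \<subseteq> insert {\<one>} (avoiding G M \<union> ?O)"
  proof
    fix U assume "U \<in> subgroups G"
    then have U: "subgroup U G" by (simp add: subgroups_def)
    have "U \<inter> M = {\<one>} \<or> U \<inter> M = M"
      using minM[of "U \<inter> M"] subgroups_Inter_pair[OF U sgM] by blast
    then show "U \<in> insert {\<one>} (avoiding G M \<union> ?O)" using U by (auto simp: avoiding_def)
  qed
  moreover have "finite ?O" by (rule finite_subset[OF _ finite_subgroups]) auto
  ultimately have "card (subgroups G) \<le> card (insert {\<one>} (avoiding G M \<union> ?O))"
    using finite_avoiding by (intro card_mono) auto
  also have "\<dots> \<le> Suc (card (avoiding G M \<union> ?O))" by (rule card_insert_le_m1) auto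
  also have "\<dots> \<le> Suc (card (avoiding G M) + card ?O)" using card_Un_le by auto
  finally show ?thesis using card_overgroups_le by linarith
qed

text \<open>By \<open>avoiding_not_commute\<close>, an avoiding subgroup fails to commute with every
  avoiding subgroup outside its own fibre, whose size \<open>card_fibre_le\<close> bounds.\<close>

lemma card_non_commuting_ge:
  "card (avoiding G M) * (card (avoiding G M) - card M)
    \<le> card {(H, K). H \<in> subgroups G \<and> K \<in> subgroups G \<and> H <#> K \<noteq> K <#> H}"
proof -
  let ?N = "avoiding G M"
  let ?D = "SIGMA U : ?N. {V \<in> ?N. V <#> M \<noteq> U <#> M}"
  have "card ?N * (card ?N - card M) = (\<Sum>U\<in>?N. card ?N - card M)" by simp
  also have "\<dots> \<le> (\<Sum>U\<in>?N. card {V \<in> ?N. V <#> M \<noteq> U <#> M})"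
  proof (rule sum_mono)
    fix U assume U: "U \<in> ?N"
    have "{V \<in> ?N. V <#> M \<noteq> U <#> M} = ?N - {V \<in> ?N. V <#> M = U <#> M}" by blast
    then have "card {V \<in> ?N. V <#> M \<noteq> U <#> M} = card ?N - card {V \<in> ?N. V <#> M = U <#> M}"
      using finite_avoiding by (simp add: card_Diff_subset)
    then show "card ?N - card M \<le> card {V \<in> ?N. V <#> M \<noteq> U <#> M}"
      using card_fibre_le[OF U] by simp
  qed
  also have "\<dots> = card ?D" using finite_avoiding by (intro card_SigmaI[symmetric]) auto
  also have "\<dots> \<le> card {(H, K). H \<in> subgroups G \<and> K \<in> subgroups G \<and> H <#> K \<noteq> K <#> H}"
  proof (rule card_mono)
    show "finite {(H, K). H \<in> subgroups G \<and> K \<in> subgroups G \<and> H <#> K \<noteq> K <#> H}"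
      by (rule finite_subset[of _ "subgroups G \<times> subgroups G"])
        (use finite_subgroups in \<open>auto simp: subgroups_def\<close>)
    show "?D \<subseteq> {(H, K). H \<in> subgroups G \<and> K \<in> subgroups G \<and> H <#> K \<noteq> K <#> H}"
    proof clarify
      fix U V assume U: "U \<in> ?N" and V: "V \<in> ?N" and ne: "V <#> M \<noteq> U <#> M"
      then show "U \<in> subgroups G \<and> V \<in> subgroups G \<and> U <#> V \<noteq> V <#> U"
        using avoiding_not_commute[OF U V ne[symmetric]] by (simp add: subgroups_def avoiding_def)
    qed
  qed
  finally show ?thesis .
qed

text \<open>It is enough that the non-commuting pairs make up at least 2/25 of all pairs. The
  counting lemmas reduce this to an inequality between \<open>n\<close> and \<open>p\<close> on the
  range \<open>n \<ge> 2 * p\<close>, \<open>p \<ge> 2\<close>.\<close>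

lemma sd_le: "sd G \<le> 23 / 25"
proof -
  let ?C = "{(H, K). H \<in> subgroups G \<and> K \<in> subgroups G \<and> H <#> K = K <#> H}"
  let ?D = "{(H, K). H \<in> subgroups G \<and> K \<in> subgroups G \<and> H <#> K \<noteq> K <#> H}"
  define n p l where "n = real (card (avoiding G M))" and "p = real (card M)"
    and "l = real (card (subgroups G))"
  have finL: "finite (subgroups G)" using finite_subgroups by (simp add: subgroups_def)
  have l0: "l > 0"
    using finL sgA unfolding l_def by (auto simp: card_gt_0_iff subgroups_def)
  have un: "?C \<union> ?D = subgroups G \<times> subgroups G" by blast
  then have "finite (?C \<union> ?D)" using finL by simp
  then have "card ?C + card ?D = card (?C \<union> ?D)" by (intro card_Un_disjoint[symmetric]) auto
  then have CD: "real (card ?C) + real (card ?D) = l\<^sup>2"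
    by (simp add: un l_def power2_eq_square card_cartesian_product flip: of_nat_add)
  have np: "n \<ge> 2 * p" using card_avoiding_ge by (simp add: n_def p_def)
  have p2: "p \<ge> 2" using card_M_ge_2 by (simp add: p_def)
  have ln: "l \<le> n + p + 4" using card_subgroups_le unfolding l_def n_def p_def by linarith
  have "n * (n - p) = real (card (avoiding G M) * (card (avoiding G M) - card M))"
    using card_avoiding_ge by (simp add: n_def p_def of_nat_diff)
  then have D: "n * (n - p) \<le> real (card ?D)"
    using card_non_commuting_ge by (simp only: of_nat_le_iff)
  have "l\<^sup>2 \<le> (n + p + 4)\<^sup>2" using ln l0 by (intro power_mono) auto
  moreover have "2 * (n + p + 4)\<^sup>2 \<le> 25 * (n * (n - p))"
  proof -
    \<comment> \<open>the difference is \<open>0\<close> for \<open>p = 2\<close>, \<open>n = 4\<close>, so expand it around that point\<close>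
    define k q where "k = n - 2 * p" and "q = p - 2"
    have "k \<ge> 0" "q \<ge> 0" using np p2 by (auto simp: k_def q_def)
    moreover have "25 * (n * (n - p)) - 2 * (n + p + 4)\<^sup>2
        = 23 * k\<^sup>2 + 63 * k * q + 110 * k + 32 * q\<^sup>2 + 80 * q"
      unfolding k_def q_def by (simp add: power2_eq_square algebra_simps)
    ultimately show ?thesis by (smt (verit) mult_nonneg_nonneg zero_le_power2)
  qed
  ultimately have "25 * real (card ?C) \<le> 23 * l\<^sup>2" using CD D by linarith
  then show ?thesis using l0 unfolding sd_def l_def[symmetric] by (simp add: field_simps)
qed

end

section \<open>Reduction to minimal cyclic pairs\<close>

text \<open>The terms of a central chain need be neither subgroups nor decreasing: the two consequences of
  nilpotency below do not require it, and chains then pass to subgroups and quotients at once.\<close>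
definition central_chain :: "('a, 'b) monoid_scheme \<Rightarrow> (nat \<Rightarrow> 'a set) \<Rightarrow> nat \<Rightarrow> bool" where
  "central_chain G \<Gamma> n \<longleftrightarrow> \<Gamma> 0 = carrier G \<and> \<Gamma> n \<subseteq> {\<one>\<^bsub>G\<^esub>} \<and> (\<forall>i. \<Gamma> i \<subseteq> carrier G) \<and>
     (\<forall>i. \<forall>x\<in>\<Gamma> i. \<forall>y\<in>carrier G. x \<otimes>\<^bsub>G\<^esub> y \<otimes>\<^bsub>G\<^esub> inv\<^bsub>G\<^esub> x \<otimes>\<^bsub>G\<^esub> inv\<^bsub>G\<^esub> y \<in> \<Gamma> (Suc i))"

text \<open>Used to find a place where a central chain enters a given subgroup.\<close>

lemma nat_last_step:
  assumes "P 0" "\<not> P n"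
  shows "\<exists>k. P k \<and> \<not> P (Suc k)"
  using assms by (induction n) auto

section \<open>Consequences of nilpotency\<close>

context group
begin

text \<open>The case \<open>M = {\<one>}\<close> is the fact that a nontrivial normal subgroup of a
  nilpotent group meets the center nontrivially. The commutators of \<open>d\<close> lie in
  \<open>N\<close> by normality and in the next term of the chain, and the part of \<open>N\<close>
  in that term is already inside \<open>M\<close>.\<close>

lemma central_chain_normal_step:
  assumes ch: "central_chain G \<Gamma> n" and M: "subgroup M G" and N: "N \<lhd> G" and "\<not> N \<subseteq> M"
  obtains d where "d \<in> N" "d \<notin> M" "\<And>s. s \<in> carrier G \<Longrightarrow> d \<otimes> s \<otimes> inv d \<otimes> inv s \<in> M"
proof -
  have sN: "subgroup N G" by (rule normal_imp_subgroup[OF N])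
  have "N \<inter> \<Gamma> 0 = N" using ch subgroup.subset[OF sN] by (auto simp: central_chain_def)
  then have 0: "\<not> N \<inter> \<Gamma> 0 \<subseteq> M" using assms by simp
  have n: "N \<inter> \<Gamma> n \<subseteq> M" using ch subgroup.one_closed[OF M] by (auto simp: central_chain_def)
  obtain k where k: "\<not> N \<inter> \<Gamma> k \<subseteq> M" "N \<inter> \<Gamma> (Suc k) \<subseteq> M"
    using nat_last_step[of "\<lambda>k. \<not> N \<inter> \<Gamma> k \<subseteq> M" n] 0 n by blast
  then obtain d where d: "d \<in> N" "d \<in> \<Gamma> k" "d \<notin> M" by blast
  have "d \<otimes> s \<otimes> inv d \<otimes> inv s \<in> M" if s: "s \<in> carrier G" for s
  proof -
    have dc: "d \<in> carrier G" by (rule subgroup.mem_carrier[OF sN d(1)])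
    have "s \<otimes> inv d \<otimes> inv s \<in> N"
      using normal.inv_op_closed2[OF N s subgroup.m_inv_closed[OF sN d(1)]] .
    then have "d \<otimes> (s \<otimes> inv d \<otimes> inv s) \<in> N" by (rule subgroup.m_closed[OF sN d(1)])
    then have "d \<otimes> s \<otimes> inv d \<otimes> inv s \<in> N" using dc s by (simp add: m_assoc)
    moreover have "d \<otimes> s \<otimes> inv d \<otimes> inv s \<in> \<Gamma> (Suc k)"
      using ch d s by (auto simp: central_chain_def)
    ultimately show ?thesis using k by blast
  qed
  then show thesis using that d by blast
qed

text \<open>The normalizer condition for nilpotent groups. The element \<open>x\<close> is taken
  from a term of the chain that is not inside \<open>K\<close> but whose successor is, so all its
  commutators lie in \<open>K\<close>.\<close>

lemma central_chain_normalizer_step: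
  assumes ch: "central_chain G \<Gamma> n" and K: "subgroup K G" "K \<noteq> carrier G"
  obtains x where "x \<in> carrier G" "x \<notin> K" "\<And>k. k \<in> K \<Longrightarrow> x \<otimes> k \<otimes> inv x \<in> K"
proof -
  have 0: "\<not> \<Gamma> 0 \<subseteq> K" using ch K subgroup.subset[OF K(1)] by (auto simp: central_chain_def)
  have n: "\<Gamma> n \<subseteq> K" using ch subgroup.one_closed[OF K(1)] by (auto simp: central_chain_def)
  obtain j where j: "\<not> \<Gamma> j \<subseteq> K" "\<Gamma> (Suc j) \<subseteq> K"
    using nat_last_step[of "\<lambda>k. \<not> \<Gamma> k \<subseteq> K" n] 0 n by blast
  then obtain x where x: "x \<in> \<Gamma> j" "x \<notin> K" by blast
  have xc: "x \<in> carrier G" using ch x by (auto simp: central_chain_def)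
  have "x \<otimes> k \<otimes> inv x \<in> K" if k: "k \<in> K" for k
  proof -
    have kc: "k \<in> carrier G" by (rule subgroup.mem_carrier[OF K(1) k])
    have "x \<otimes> k \<otimes> inv x \<otimes> inv k \<in> \<Gamma> (Suc j)"
      using ch x kc by (auto simp: central_chain_def)
    then have "x \<otimes> k \<otimes> inv x \<otimes> inv k \<in> K" using j by blast
    then have "x \<otimes> k \<otimes> inv x \<otimes> inv k \<otimes> k \<in> K" using k by (rule subgroup.m_closed[OF K(1)])
    then show ?thesis using xc kc by (simp add: m_assoc)
  qed
  then show thesis using that x xc by blast
qed

end

text \<open>In a critical pair this is the unique maximal subgroup of the cyclic group
  \<open>A\<close>. As a set of elements it contains every proper subgroup of \<open>A\<close> at
  once, and closure under multiplication is what has to be proved.\<close>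

definition nongenerators :: "('a, 'b) monoid_scheme \<Rightarrow> 'a set \<Rightarrow> 'a set" where
  "nongenerators G A = {x \<in> A. generate G {x} \<noteq> A}"

text \<open>A minimal section with a minimal non-commuting pair. \<open>quotient_commute\<close>
  says that the subgroups of the quotient by \<open>W\<close> commute, expressed by their preimages;
  \<open>smaller_A\<close> and \<open>smaller_B\<close> come from the minimality of
  \<open>card A + card B\<close>.\<close>

locale critical_pair = group G for G (structure) +
  fixes A B \<Gamma> n
  assumes fin: "finite (carrier G)"
    and chain: "central_chain G \<Gamma> n"
    and proper_commute: "\<lbrakk>subgroup K G; K \<noteq> carrier G; subgroup U G; subgroup V G; U \<subseteq> K; V \<subseteq> K\<rbrakk>
      \<Longrightarrow> U <#> V = V <#> U"
    and quotient_commute: "\<lbrakk>W \<lhd> G; W \<noteq> {\<one>}; subgroup U G; subgroup V G; W \<subseteq> U; W \<subseteq> V\<rbrakk>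
      \<Longrightarrow> U <#> V = V <#> U"
    and sgA: "subgroup A G" and sgB: "subgroup B G"
    and AB_not_commute: "A <#> B \<noteq> B <#> A"
    and smaller_A: "\<lbrakk>subgroup C G; C \<subset> A\<rbrakk> \<Longrightarrow> C <#> B = B <#> C"
    and smaller_B: "\<lbrakk>subgroup C G; C \<subset> B\<rbrakk> \<Longrightarrow> C <#> A = A <#> C"
begin

section \<open>The structure of a critical pair\<close>

lemma swap: "critical_pair G B A \<Gamma> n"
  by (intro critical_pair.intro critical_pair_axioms.intro)
    (fact is_group fin chain proper_commute quotient_commute sgA sgB AB_not_commute[symmetric]
      smaller_A smaller_B)+

lemma A_carrier: "x \<in> A \<Longrightarrow> x \<in> carrier G"
  by (rule subgroup.mem_carrier[OF sgA])

lemma B_carrier: "x \<in> B \<Longrightarrow> x \<in> carrier G"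
  by (rule subgroup.mem_carrier[OF sgB])

text \<open>If \<open>W\<close> were inside \<open>A\<close>, then \<open>A\<close> and
  \<open>B <#> W\<close> would commute by \<open>quotient_commute\<close>. Their two products are
  \<open>A <#> B\<close> and \<open>B <#> A\<close>, since \<open>A\<close> absorbs
  \<open>W\<close>.\<close>

lemma normal_not_subset_A:
  assumes W: "W \<lhd> G" "W \<noteq> {\<one>}"
  shows "\<not> W \<subseteq> A"
proof
  assume WA: "W \<subseteq> A"
  have sW: "subgroup W G" by (rule normal_imp_subgroup[OF W(1)])
  have BW: "B <#> W = W <#> B" by (rule commut_normal[OF sgB W(1)])
  have "A <#> (B <#> W) = (B <#> W) <#> A"
    by (rule quotient_commute[OF W sgA subgroup_set_mult[OF sgB sW BW] WA])
      (auto intro: set_mult_memI2[OF sgB sW])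
  moreover have "A <#> (B <#> W) = A <#> B"
    unfolding BW
    by (simp add: set_mult_assoc[symmetric] subgroup.subset sgA sgB sW set_mult_absorb[OF sgA sW WA])
  moreover have "(B <#> W) <#> A = B <#> A"
    by (simp add: set_mult_assoc subgroup.subset sgA sgB sW set_mult_absorb[OF sgA sW WA])
  ultimately show False using AB_not_commute by simp
qed

text \<open>A nontrivial central element would generate a nontrivial normal subgroup inside
  \<open>A\<close>.\<close>

lemma central_in_A_trivial:
  assumes x: "x \<in> A" and c: "\<And>y. y \<in> carrier G \<Longrightarrow> x \<otimes> y = y \<otimes> x"
  shows "x = \<one>"
proof (rule ccontr)
  assume x1: "x \<noteq> \<one>"
  have xc: "x \<in> carrier G" by (rule A_carrier[OF x])
  have "generate G {x} \<lhd> G"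
    by (rule central_normal[OF generate_singleton_subgroup[OF xc] generate_central[OF xc c]])
  moreover have "generate G {x} \<noteq> {\<one>}" using generate_singleton_self[of x] x1 by blast
  ultimately show False
    using normal_not_subset_A generate_singleton_minimal[OF sgA x] by blast
qed

lemma A_nontrivial: "A \<noteq> {\<one>}"
proof
  assume A: "A = {\<one>}"
  have "A <#> B = B <#> A" using B_carrier unfolding A set_mult_def by auto
  then show False using AB_not_commute by simp
qed

text \<open>Otherwise \<open>A\<close> would be a union of proper cyclic subgroups, each of which
  commutes with \<open>B\<close>.\<close>

lemma A_cyclic: "\<exists>a\<in>A. generate G {a} = A"
proof (rule ccontr)
  assume no: "\<not> (\<exists>a\<in>A. generate G {a} = A)"
  have "A <#> B \<subseteq> B <#> A"
  proof
    fix u assume "u \<in> A <#> B"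
    then obtain x y where xy: "x \<in> A" "y \<in> B" "u = x \<otimes> y" by (rule set_multE)
    let ?C = "generate G {x}"
    have C: "?C \<subset> A" using no xy(1) generate_singleton_minimal[OF sgA xy(1)] by blast
    have "u \<in> ?C <#> B" unfolding xy(3) by (rule set_multI[OF generate_singleton_self xy(2)])
    also have "\<dots> = B <#> ?C"
      by (rule smaller_A[OF generate_singleton_subgroup[OF A_carrier[OF xy(1)]] C])
    also have "\<dots> \<subseteq> B <#> A" using C by (intro mono_set_mult) auto
    finally show "u \<in> B <#> A" .
  qed
  then show False using AB_not_commute set_mult_commute_if_subset[OF sgA sgB] by blast
qed

lemma A_comm:
  assumes x: "x \<in> A" and y: "y \<in> A"
  shows "x \<otimes> y = y \<otimes> x"
proof -
  obtain a where a: "a \<in> A" "generate G {a} = A" using A_cyclic by blast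
  let ?C = "\<lambda>u. {s \<in> carrier G. \<forall>t\<in>{u}. s \<otimes> t = t \<otimes> s}"
  have sub: "A \<subseteq> ?C u" if u: "u \<in> carrier G" "a \<otimes> u = u \<otimes> a" for u
  proof -
    have "generate G {a} \<subseteq> ?C u"
      using u A_carrier[OF a(1)] by (intro generate_singleton_minimal subgroup_centralizer) auto
    then show ?thesis using a(2) by simp
  qed
  have "a \<otimes> y = y \<otimes> a" using sub[of a] A_carrier[OF a(1)] y by fastforce
  then show ?thesis using sub[of y] A_carrier[OF y] x by blast
qed

lemma nongenerators_subset: "nongenerators G A \<subseteq> A"
  by (auto simp: nongenerators_def)

lemma nongenerators_psubset: "nongenerators G A \<subset> A"
  using A_cyclic by (auto simp: nongenerators_def)

lemma proper_subset_nongenerators: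
  assumes C: "subgroup C G" "C \<subset> A"
  shows "C \<subseteq> nongenerators G A"
proof
  fix x assume "x \<in> C"
  then show "x \<in> nongenerators G A"
    using generate_singleton_minimal[OF C(1), of x] C(2) by (auto simp: nongenerators_def)
qed

text \<open>The subgroups generated by two nongenerators both commute with \<open>B\<close>, hence
  so does their product, which therefore cannot be \<open>A\<close>. Being a proper subgroup of
  \<open>A\<close>, the product consists of nongenerators.\<close>

lemma subgroup_nongenerators: "subgroup (nongenerators G A) G"
proof (rule subgroupI)
  show "nongenerators G A \<subseteq> carrier G" using A_carrier by (auto simp: nongenerators_def)
  have "generate G {\<one>} \<subseteq> {\<one>}" by (rule generate_singleton_minimal[OF triv_subgroup]) simp
  then have "generate G {\<one>} \<noteq> A" using A_nontrivial subgroup.one_closed[OF sgA] by blast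
  then show "nongenerators G A \<noteq> {}"
    using subgroup.one_closed[OF sgA] by (auto simp: nongenerators_def)
next
  fix x assume "x \<in> nongenerators G A"
  then have x: "x \<in> A" "generate G {x} \<noteq> A" by (auto simp: nongenerators_def)
  have C: "subgroup (generate G {x}) G" by (rule generate_singleton_subgroup[OF A_carrier[OF x(1)]])
  have "generate G {x} \<subset> A" using x(2) generate_singleton_minimal[OF sgA x(1)] by blast
  then show "inv x \<in> nongenerators G A"
    using proper_subset_nongenerators[OF C] subgroup.m_inv_closed[OF C generate_singleton_self] by blast
next
  fix x y assume "x \<in> nongenerators G A" "y \<in> nongenerators G A"
  then have x: "x \<in> A" "generate G {x} \<noteq> A" and y: "y \<in> A" "generate G {y} \<noteq> A"
    by (auto simp: nongenerators_def)
  let ?C = "generate G {x}" and ?D = "generate G {y}"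
  have C: "subgroup ?C G" by (rule generate_singleton_subgroup[OF A_carrier[OF x(1)]])
  have D: "subgroup ?D G" by (rule generate_singleton_subgroup[OF A_carrier[OF y(1)]])
  have CA: "?C \<subset> A" using x(2) generate_singleton_minimal[OF sgA x(1)] by blast
  have DA: "?D \<subset> A" using y(2) generate_singleton_minimal[OF sgA y(1)] by blast
  have "?C <#> ?D \<subseteq> ?D <#> ?C"
  proof
    fix u assume "u \<in> ?C <#> ?D"
    then obtain c d where cd: "c \<in> ?C" "d \<in> ?D" "u = c \<otimes> d" by (rule set_multE)
    then have "u = d \<otimes> c" using A_comm[of c d] CA DA by blast
    then show "u \<in> ?D <#> ?C" using cd by (simp add: set_multI)
  qed
  then have CD: "subgroup (?C <#> ?D) G"
    by (intro subgroup_set_mult C D set_mult_commute_if_subset)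
  have "?C <#> ?D \<noteq> A"
  proof
    assume A: "?C <#> ?D = A"
    note sub = subgroup.subset[OF C] subgroup.subset[OF D] subgroup.subset[OF sgB]
    have "A <#> B = ?C <#> (?D <#> B)" unfolding A[symmetric] using sub by (rule set_mult_assoc)
    also have "\<dots> = ?C <#> (B <#> ?D)" using smaller_A[OF D DA] by simp
    also have "\<dots> = ?C <#> B <#> ?D" using sub by (simp add: set_mult_assoc)
    also have "\<dots> = B <#> ?C <#> ?D" using smaller_A[OF C CA] by simp
    also have "\<dots> = B <#> A" using sub by (simp add: set_mult_assoc A)
    finally show False using AB_not_commute by simp
  qed
  moreover have "?C <#> ?D \<subseteq> A" by (rule set_mult_subset_subgroup[OF sgA]) (use CA DA in auto)
  ultimately have "?C <#> ?D \<subseteq> nongenerators G A"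
    by (intro proper_subset_nongenerators CD) blast
  moreover have "x \<otimes> y \<in> ?C <#> ?D"
    by (intro set_multI generate_singleton_self)
  ultimately show "x \<otimes> y \<in> nongenerators G A" by blast
qed

text \<open>\<open>central_chain_normal_step\<close>, applied to the trivial subgroup and the whole
  group, yields a nontrivial central element \<open>d\<close>. A nontrivial subgroup of least order
  inside \<open>generate G {d}\<close> is as required.\<close>

lemma obtain_minimal_central:
  obtains M where "subgroup M G" "M \<noteq> {\<one>}"
    "\<And>m x. \<lbrakk>m \<in> M; x \<in> carrier G\<rbrakk> \<Longrightarrow> m \<otimes> x = x \<otimes> m"
    "\<And>C. \<lbrakk>subgroup C G; C \<subseteq> M\<rbrakk> \<Longrightarrow> C = {\<one>} \<or> C = M"
proof -
  have nt: "\<not> carrier G \<subseteq> {\<one>}"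
    using A_nontrivial subgroup.subset[OF sgA] subgroup.one_closed[OF sgA] by blast
  have G: "carrier G \<lhd> G" by (auto simp: normal_inv_iff subgroup_self)
  obtain d where d: "d \<in> carrier G" "d \<notin> {\<one>}"
    "\<And>s. s \<in> carrier G \<Longrightarrow> d \<otimes> s \<otimes> inv d \<otimes> inv s \<in> {\<one>}"
    using central_chain_normal_step[OF chain triv_subgroup G nt] by blast
  have dc: "d \<otimes> s = s \<otimes> d" if s: "s \<in> carrier G" for s
  proof -
    have "d \<otimes> s = (d \<otimes> s \<otimes> inv d \<otimes> inv s) \<otimes> (s \<otimes> d)" using s d(1) by (simp add: word_simps)
    then show ?thesis using d(1) d(3)[OF s] s by simp
  qed
  let ?P = "\<lambda>M. subgroup M G \<and> M \<noteq> {\<one>} \<and> M \<subseteq> generate G {d}"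
  have "?P (generate G {d})"
    using generate_singleton_subgroup[OF d(1)] generate_singleton_self[of d] d(2) by blast
  from ex_has_least_nat[of ?P, OF this, of card]
  obtain M where "?P M \<and> (\<forall>C. ?P C \<longrightarrow> card M \<le> card C)" by (rule exE)
  then have M: "?P M" and least: "\<forall>C. ?P C \<longrightarrow> card M \<le> card C" by (rule conjunct1, rule conjunct2)
  show thesis
  proof (rule that[of M])
    show "m \<otimes> x = x \<otimes> m" if "m \<in> M" "x \<in> carrier G" for m x
      using generate_central[OF d(1) dc] M that by blast
    show "C = {\<one>} \<or> C = M" if C: "subgroup C G" "C \<subseteq> M" for C
    proof (cases "C = {\<one>}")
      case False
      then have "card M \<le> card C" using least C M by blast
      moreover have "finite M" using M by (meson fin finite_subset subgroup.subset)
      ultimately show ?thesis using C(2) card_seteq by blast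
    qed simp
  qed (use M in auto)
qed

end

text \<open>Fixing \<open>M\<close> as a parameter keeps it the same when \<open>swap_triple\<close>
  exchanges \<open>A\<close> and \<open>B\<close>.\<close>

locale critical_triple = critical_pair +
  fixes M
  assumes sgM: "subgroup M G" and M_nontrivial: "M \<noteq> {\<one>}"
    and M_central: "\<lbrakk>m \<in> M; x \<in> carrier G\<rbrakk> \<Longrightarrow> m \<otimes> x = x \<otimes> m"
    and minM: "\<lbrakk>subgroup C G; C \<subseteq> M\<rbrakk> \<Longrightarrow> C = {\<one>} \<or> C = M"
begin

section \<open>Maximal subgroups and commutators in a critical triple\<close>

abbreviation "A1 \<equiv> nongenerators G A"
abbreviation "B1 \<equiv> nongenerators G B"

lemma swap_triple: "critical_triple G B A \<Gamma> n M"
  by (intro critical_triple.intro critical_triple_axioms.intro swap)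
    (fact sgM M_nontrivial M_central minM)+

lemma M_carrier: "x \<in> M \<Longrightarrow> x \<in> carrier G"
  by (rule subgroup.mem_carrier[OF sgM])

text \<open>\<open>A <#> M\<close> and \<open>B <#> M\<close> commute because both contain
  \<open>M\<close>, so their product is a subgroup. It contains \<open>A\<close> and
  \<open>B\<close> and thus cannot be proper, by \<open>proper_commute\<close>.\<close>

lemma decomp: "carrier G \<subseteq> A <#> B <#> M"
proof -
  have sAM: "subgroup (A <#> M) G" by (rule subgroup_mult_central[OF sgA sgM M_central])
  have sBM: "subgroup (B <#> M) G" by (rule subgroup_mult_central[OF sgB sgM M_central])
  have com: "(A <#> M) <#> (B <#> M) = (B <#> M) <#> (A <#> M)"
    by (rule quotient_commute[OF central_normal[OF sgM M_central] M_nontrivial sAM sBM])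
      (auto intro: set_mult_memI2[OF _ sgM] sgA sgB)
  have sT: "subgroup ((A <#> M) <#> (B <#> M)) G" by (rule subgroup_set_mult[OF sAM sBM com])
  have "A \<subseteq> (A <#> M) <#> (B <#> M)" "B \<subseteq> (A <#> M) <#> (B <#> M)"
    using set_mult_memI1[OF sAM sBM set_mult_memI1[OF sgA sgM]]
      set_mult_memI2[OF sAM sBM set_mult_memI1[OF sgB sgM]] by blast+
  then have T: "(A <#> M) <#> (B <#> M) = carrier G"
    using proper_commute[OF sT _ sgA sgB] AB_not_commute by blast
  show ?thesis
  proof
    fix s assume "s \<in> carrier G"
    then have "s \<in> (A <#> M) <#> (B <#> M)" unfolding T .
    then obtain u v where uv: "u \<in> A <#> M" "v \<in> B <#> M" "s = u \<otimes> v" by (rule set_multE)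
    obtain x m where x: "x \<in> A" "m \<in> M" "u = x \<otimes> m" using uv(1) by (rule set_multE)
    obtain y m' where y: "y \<in> B" "m' \<in> M" "v = y \<otimes> m'" using uv(2) by (rule set_multE)
    have c: "x \<in> carrier G" "m \<in> carrier G" "y \<in> carrier G" "m' \<in> carrier G"
      using x y A_carrier B_carrier M_carrier by auto
    have "s = x \<otimes> (m \<otimes> y) \<otimes> m'" using uv x y c by (simp add: m_assoc)
    also have "m \<otimes> y = y \<otimes> m" by (rule M_central[OF x(2) c(3)])
    also have "x \<otimes> (y \<otimes> m) \<otimes> m' = (x \<otimes> y) \<otimes> (m \<otimes> m')" using c by (simp add: m_assoc)
    finally show "s \<in> A <#> B <#> M"
      using x y subgroup.m_closed[OF sgM] by (simp add: set_multI)
  qed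
qed

lemma decompE:
  assumes "s \<in> carrier G"
  obtains x y m where "x \<in> A" "y \<in> B" "m \<in> M" "s = x \<otimes> y \<otimes> m"
  by (rule set_mult3E[OF subsetD[OF decomp assms]])

lemmas covers = subgroup_covers[OF _ _ _ _ decomp]

text \<open>\<open>B <#> M\<close> is abelian, so inside it \<open>A\<close> would commute with
  \<open>B\<close> elementwise.\<close>

lemma A_not_subset_BM: "\<not> A \<subseteq> B <#> M"
proof
  assume sub: "A \<subseteq> B <#> M"
  have "A <#> B \<subseteq> B <#> A"
  proof
    fix u assume "u \<in> A <#> B"
    then obtain x y where xy: "x \<in> A" "y \<in> B" "u = x \<otimes> y" by (rule set_multE)
    have "x \<in> B <#> M" using sub xy(1) by blast
    then obtain y' m where x: "y' \<in> B" "m \<in> M" "x = y' \<otimes> m" by (rule set_multE)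
    have c: "y \<in> carrier G" "y' \<in> carrier G" "m \<in> carrier G"
      using xy x B_carrier M_carrier by auto
    have "u = y' \<otimes> (m \<otimes> y)" using xy x c by (simp add: m_assoc)
    also have "m \<otimes> y = y \<otimes> m" by (rule M_central[OF x(2) c(1)])
    also have "y' \<otimes> (y \<otimes> m) = (y' \<otimes> y) \<otimes> m" using c by (simp add: m_assoc)
    also have "y' \<otimes> y = y \<otimes> y'" by (rule critical_pair.A_comm[OF swap x(1) xy(2)])
    also have "y \<otimes> y' \<otimes> m = y \<otimes> x" using x c by (simp add: m_assoc)
    finally show "u \<in> B <#> A" using xy by (simp add: set_multI)
  qed
  then show False using AB_not_commute set_mult_commute_if_subset[OF sgA sgB] by blast
qed

text \<open>The two maximal subgroups of the overview. \<open>L\<close> is spelled so that it is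
  literally the \<open>K\<close> of \<open>swap_triple\<close>.\<close>

abbreviation "K \<equiv> A1 <#> B <#> M"
abbreviation "L \<equiv> B1 <#> A <#> M"

lemma A1_B_commute: "A1 <#> B = B <#> A1"
  by (rule smaller_A[OF subgroup_nongenerators nongenerators_psubset])

lemma subgroup_A1_B: "subgroup (A1 <#> B) G"
  by (rule subgroup_set_mult[OF subgroup_nongenerators sgB A1_B_commute])

lemma subgroup_K: "subgroup K G"
  by (rule subgroup_mult_central[OF subgroup_A1_B sgM M_central])

lemma A1_subset_K: "A1 \<subseteq> K" and B_subset_K: "B \<subseteq> K" and M_subset_K: "M \<subseteq> K"
  using set_mult_memI1[OF subgroup_A1_B sgM set_mult_memI1[OF subgroup_nongenerators sgB]]
    set_mult_memI1[OF subgroup_A1_B sgM set_mult_memI2[OF subgroup_nongenerators sgB]]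
    set_mult_memI2[OF subgroup_A1_B sgM] by blast+

text \<open>Removing the \<open>A1\<close>-component from an element of \<open>K \<inter> A\<close>
  leaves an element of \<open>A \<inter> (B <#> M)\<close>. This is a proper subgroup of
  \<open>A\<close> by \<open>A_not_subset_BM\<close>, hence inside \<open>A1\<close>. It follows
  that \<open>K\<close> is proper.\<close>

lemma K_Int_A: "K \<inter> A = A1"
proof
  show "A1 \<subseteq> K \<inter> A" using A1_subset_K nongenerators_subset by blast
  show "K \<inter> A \<subseteq> A1"
  proof
    fix x assume x: "x \<in> K \<inter> A"
    then obtain u m where u: "u \<in> A1 <#> B" "m \<in> M" "x = u \<otimes> m" by (blast elim: set_multE)
    obtain w y where w: "w \<in> A1" "y \<in> B" "u = w \<otimes> y" using u(1) by (rule set_multE)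
    have wA: "w \<in> A" using w(1) nongenerators_subset by blast
    have c: "w \<in> carrier G" "y \<in> carrier G" "m \<in> carrier G"
      using w u wA A_carrier B_carrier M_carrier by auto
    have eq: "inv w \<otimes> x = y \<otimes> m" using u w c by (simp add: word_simps)
    have "inv w \<otimes> x \<in> A"
      using x wA sgA by (simp add: subgroup.m_closed subgroup.m_inv_closed)
    moreover have "inv w \<otimes> x \<in> B <#> M" unfolding eq by (rule set_multI[OF w(2) u(2)])
    ultimately have 1: "inv w \<otimes> x \<in> A \<inter> (B <#> M)" by blast
    have sg: "subgroup (A \<inter> (B <#> M)) G"
      by (rule subgroups_Inter_pair[OF sgA subgroup_mult_central[OF sgB sgM M_central]])
    have "A \<inter> (B <#> M) \<subset> A" using A_not_subset_BM by blast
    then have "inv w \<otimes> x \<in> A1" using 1 proper_subset_nongenerators[OF sg] by blast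
    then have "w \<otimes> (inv w \<otimes> x) \<in> A1" by (rule subgroup.m_closed[OF subgroup_nongenerators w(1)])
    then show "x \<in> A1" using c x A_carrier by (simp add: mult_inv_cancel)
  qed
qed

text \<open>A proper subgroup \<open>K\<close> of a nilpotent group is properly contained in its normalizer, and
  \<open>K\<close> is maximal because every subgroup of \<open>A\<close> that exceeds \<open>A1\<close> is all of \<open>A\<close>.\<close>
lemma normal_K: "K \<lhd> G"
proof -
  have "K \<noteq> carrier G"
    using K_Int_A nongenerators_psubset subgroup.subset[OF sgA] by blast
  then obtain x where x: "x \<in> carrier G" "x \<notin> K" "\<And>k. k \<in> K \<Longrightarrow> x \<otimes> k \<otimes> inv x \<in> K"
    using central_chain_normalizer_step[OF chain subgroup_K] by blast
  have Kc: "k \<in> carrier G" if "k \<in> K" for k by (rule subgroup.mem_carrier[OF subgroup_K that])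
  \<comment> \<open>The normalizer of \<open>K\<close>; imposing the condition for both
    \<open>s\<close> and \<open>inv s\<close> makes closure under inverses immediate.\<close>
  let ?N = "{s \<in> carrier G. \<forall>k\<in>K. s \<otimes> k \<otimes> inv s \<in> K \<and> inv s \<otimes> k \<otimes> s \<in> K}"
  have sN: "subgroup ?N G"
  proof (rule subgroupI)
    have "\<one> \<in> ?N" using Kc by auto
    then show "?N \<noteq> {}" by blast
  next
    fix s assume "s \<in> ?N"
    then show "inv s \<in> ?N" by auto
  next
    fix s t assume s: "s \<in> ?N" and t: "t \<in> ?N"
    have "(s \<otimes> t) \<otimes> k \<otimes> inv (s \<otimes> t) \<in> K \<and> inv (s \<otimes> t) \<otimes> k \<otimes> (s \<otimes> t) \<in> K" if k: "k \<in> K" for k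
    proof -
      have c: "s \<in> carrier G" "t \<in> carrier G" "k \<in> carrier G" using s t k Kc by auto
      have "s \<otimes> (t \<otimes> k \<otimes> inv t) \<otimes> inv s \<in> K" "inv t \<otimes> (inv s \<otimes> k \<otimes> s) \<otimes> t \<in> K"
        using s t k by blast+
      then show ?thesis using c by (simp add: word_simps)
    qed
    then show "s \<otimes> t \<in> ?N" using s t by blast
  qed auto
  have KN: "K \<subseteq> ?N"
  proof
    fix s assume s: "s \<in> K"
    then show "s \<in> ?N"
      using subgroup_K Kc by (auto simp: subgroup.m_closed subgroup.m_inv_closed)
  qed
  \<comment> \<open>Conjugation by \<open>x\<close> is so far only known to map \<open>K\<close>
    into itself. Finiteness makes it a bijection, so \<open>inv x\<close> preserves \<open>K\<close>
    as well.\<close>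
  have surj: "(\<lambda>k. x \<otimes> k \<otimes> inv x) ` K = K"
  proof (rule endo_inj_surj)
    show "finite K" by (rule finite_subset[OF subgroup.subset[OF subgroup_K] fin])
    show "(\<lambda>k. x \<otimes> k \<otimes> inv x) ` K \<subseteq> K" using x(3) by blast
    show "inj_on (\<lambda>k. x \<otimes> k \<otimes> inv x) K"
    proof (rule inj_onI)
      fix k k' assume k: "k \<in> K" "k' \<in> K" "x \<otimes> k \<otimes> inv x = x \<otimes> k' \<otimes> inv x"
      then show "k = k'" using x(1) Kc[OF k(1)] Kc[OF k(2)] by simp
    qed
  qed
  have "inv x \<otimes> k \<otimes> x \<in> K" if k: "k \<in> K" for k
  proof -
    obtain k' where k': "k' \<in> K" "k = x \<otimes> k' \<otimes> inv x" using surj k by blast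
    have "inv x \<otimes> k \<otimes> x = k'" using k' Kc[OF k'(1)] x(1) by (simp add: word_simps)
    then show ?thesis using k' by simp
  qed
  then have xN: "x \<in> ?N" using x by blast
  \<comment> \<open>Otherwise \<open>?N \<inter> A\<close> lies in \<open>A1\<close>. Stripping from
    \<open>x\<close> its factors in \<open>B\<close> and \<open>M\<close>, which lie in
    \<open>K\<close> and so in \<open>?N\<close>, leaves a component \<open>w\<close> in
    \<open>?N \<inter> A\<close>; then \<open>w\<close> and hence \<open>x\<close> would be in
    \<open>K\<close>.\<close>
  have "A \<subseteq> ?N"
  proof (rule ccontr)
    assume "\<not> A \<subseteq> ?N"
    then have "?N \<inter> A \<subset> A" by blast
    then have NA: "?N \<inter> A \<subseteq> A1"
      by (rule proper_subset_nongenerators[OF subgroups_Inter_pair[OF sN sgA]])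
    obtain w y m where wym: "w \<in> A" "y \<in> B" "m \<in> M" "x = w \<otimes> y \<otimes> m" by (rule decompE[OF x(1)])
    have c: "w \<in> carrier G" "y \<in> carrier G" "m \<in> carrier G"
      using wym A_carrier B_carrier M_carrier by auto
    have ymK: "y \<otimes> m \<in> K"
      by (rule subgroup.m_closed[OF subgroup_K]) (use wym B_subset_K M_subset_K in auto)
    have "inv (y \<otimes> m) \<in> ?N"
      by (rule subsetD[OF KN subgroup.m_inv_closed[OF subgroup_K ymK]])
    then have "x \<otimes> inv (y \<otimes> m) \<in> ?N" by (rule subgroup.m_closed[OF sN xN])
    moreover have "x \<otimes> inv (y \<otimes> m) = w" using wym c by (simp add: word_simps)
    ultimately have "w \<in> K" using NA wym(1) A1_subset_K by auto
    then have "w \<otimes> (y \<otimes> m) \<in> K" using ymK by (rule subgroup.m_closed[OF subgroup_K])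
    then show False using x(2) wym c by (simp add: m_assoc)
  qed
  then have "?N = carrier G"
    using KN B_subset_K M_subset_K by (intro covers[OF sN]) auto
  then show ?thesis using subgroup_K unfolding normal_inv_iff by blast
qed

lemma normal_L: "L \<lhd> G"
  by (rule critical_triple.normal_K[OF swap_triple])

lemma L_Int_B: "L \<inter> B = B1"
  by (rule critical_triple.K_Int_A[OF swap_triple])

lemma A_subset_L: "A \<subseteq> L" and M_subset_L: "M \<subseteq> L"
  by (rule critical_triple.B_subset_K[OF swap_triple], rule critical_triple.M_subset_K[OF swap_triple])

text \<open>A nontrivial commutator of \<open>b\<close> with an element of \<open>A\<close> would
  lie in both \<open>M\<close> and the subgroup \<open>A <#> B1\<close>, so \<open>M\<close> would
  be inside \<open>A <#> B1\<close> and \<open>G = A <#> B\<close>, making \<open>A\<close> and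
  \<open>B\<close> commute. So \<open>b\<close> centralizes all three factors, and
  \<open>central_in_A_trivial\<close> applies to \<open>B\<close>.\<close>

lemma nongenerator_B_trivial:
  assumes b: "b \<in> B1" and com: "\<And>x. x \<in> A \<Longrightarrow> b \<otimes> x \<otimes> inv b \<otimes> inv x \<in> M"
  shows "b = \<one>"
proof -
  have sB1: "subgroup B1 G" by (rule critical_pair.subgroup_nongenerators[OF swap])
  have B1B: "B1 \<subseteq> B" by (rule critical_pair.nongenerators_subset[OF swap])
  have bB: "b \<in> B" using b B1B by blast
  have bc: "b \<in> carrier G" by (rule B_carrier[OF bB])
  have B1A: "A <#> B1 = B1 <#> A"
    using smaller_B[OF sB1 critical_pair.nongenerators_psubset[OF swap]] by simp
  have sAB1: "subgroup (A <#> B1) G" by (rule subgroup_set_mult[OF sgA sB1 B1A])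
  have A: "A \<subseteq> A <#> B1" and B1: "B1 \<subseteq> A <#> B1"
    using set_mult_memI1[OF sgA sB1] set_mult_memI2[OF sgA sB1] by blast+
  have bA: "b \<otimes> x = x \<otimes> b" if x: "x \<in> A" for x
  proof (rule ccontr)
    assume ne: "b \<otimes> x \<noteq> x \<otimes> b"
    have xc: "x \<in> carrier G" by (rule A_carrier[OF x])
    let ?m = "b \<otimes> x \<otimes> inv b \<otimes> inv x"
    have "b \<otimes> x = ?m \<otimes> (x \<otimes> b)" using xc bc by (simp add: word_simps)
    then have "?m \<noteq> \<one>" using ne xc bc by auto
    moreover have "?m \<in> A <#> B1"
      using A B1 b x sAB1 by (meson subgroup.m_closed subgroup.m_inv_closed subsetD)
    ultimately have "M \<inter> (A <#> B1) = M"
      using minM[OF subgroups_Inter_pair[OF sgM sAB1]] com[OF x] by blast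
    then have MAB: "M \<subseteq> A <#> B1" by blast
    have "carrier G \<subseteq> A <#> B"
    proof
      fix s assume "s \<in> carrier G"
      then obtain w y m where wym: "w \<in> A" "y \<in> B" "m \<in> M" "s = w \<otimes> y \<otimes> m" by (rule decompE)
      have "w \<otimes> m \<in> A <#> B1" by (rule subgroup.m_closed[OF sAB1]) (use A MAB wym in auto)
      then obtain w' y' where w': "w' \<in> A" "y' \<in> B1" "w \<otimes> m = w' \<otimes> y'" by (rule set_multE)
      have y'B: "y' \<in> B" using w' B1B by blast
      have c: "w \<in> carrier G" "y \<in> carrier G" "m \<in> carrier G" "w' \<in> carrier G" "y' \<in> carrier G"
        using wym w' y'B A_carrier B_carrier M_carrier by auto
      have "s = w \<otimes> (y \<otimes> m)" using wym c by (simp add: m_assoc)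
      also have "y \<otimes> m = m \<otimes> y" by (rule M_central[OF wym(3) c(2), symmetric])
      also have "w \<otimes> (m \<otimes> y) = (w \<otimes> m) \<otimes> y" using c by (simp add: m_assoc)
      also have "\<dots> = w' \<otimes> (y' \<otimes> y)" using w' c by (simp add: m_assoc)
      finally show "s \<in> A <#> B"
        using w' y'B wym subgroup.m_closed[OF sgB] by (simp add: set_multI)
    qed
    then show False using AB_not_commute set_mult_commute_if_covers[OF sgA sgB] by blast
  qed
  let ?C = "{s \<in> carrier G. \<forall>t\<in>{b}. s \<otimes> t = t \<otimes> s}"
  have "?C = carrier G"
  proof (rule covers)
    show "subgroup ?C G" using bc by (intro subgroup_centralizer) simp
    show "A \<subseteq> ?C" using bA A_carrier by auto
    show "B \<subseteq> ?C" using critical_pair.A_comm[OF swap _ bB] B_carrier by auto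
    show "M \<subseteq> ?C" using M_central[OF _ bc] M_carrier by auto
  qed
  then have "b \<otimes> y = y \<otimes> b" if "y \<in> carrier G" for y using that by force
  then show ?thesis by (rule critical_pair.central_in_A_trivial[OF swap bB])
qed

text \<open>An element \<open>d\<close> of the intersection outside \<open>M\<close> can be chosen
  central modulo \<open>M\<close>. Writing \<open>d = a \<otimes> b \<otimes> m\<close>, the
  component \<open>b\<close> commutes with \<open>A\<close> modulo \<open>M\<close> because
  \<open>a\<close>, \<open>d\<close> and \<open>m\<close> do, and likewise \<open>a\<close> with
  \<open>B\<close>. Both are then trivial and \<open>d = m\<close>.\<close>

lemma K_Int_L_subset_M: "K \<inter> L \<subseteq> M"
proof (rule ccontr)
  assume "\<not> K \<inter> L \<subseteq> M"
  moreover have "K \<inter> L \<lhd> G" by (rule normal_subgroup_intersect[OF normal_K normal_L])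
  ultimately obtain d where d: "d \<in> K \<inter> L" "d \<notin> M"
    and dM: "\<And>s. s \<in> carrier G \<Longrightarrow> d \<otimes> s \<otimes> inv d \<otimes> inv s \<in> M"
    using central_chain_normal_step[OF chain sgM] by blast
  obtain u m where u: "u \<in> A1 <#> B" "m \<in> M" "d = u \<otimes> m" using d(1) by (blast elim: set_multE)
  obtain a b where ab: "a \<in> A1" "b \<in> B" "u = a \<otimes> b" using u(1) by (rule set_multE)
  have aA: "a \<in> A" using ab(1) nongenerators_subset by blast
  have c: "a \<in> carrier G" "b \<in> carrier G" "m \<in> carrier G"
    using u ab aA A_carrier B_carrier M_carrier by auto
  have sL: "subgroup L G" by (rule normal_imp_subgroup[OF normal_L])
  have b_eq: "b = inv a \<otimes> d \<otimes> inv m" and a_eq: "a = d \<otimes> inv m \<otimes> inv b"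
    using u ab c by (simp_all add: word_simps)
  have mL: "a \<in> L" "d \<in> L" "m \<in> L" using aA d u A_subset_L M_subset_L by auto
  have "inv a \<otimes> d \<otimes> inv m \<in> L"
    by (intro subgroup.m_closed[OF sL] subgroup.m_inv_closed[OF sL] mL)
  \<comment> \<open>The decomposition of \<open>d\<close> as an element of \<open>K\<close> puts
    only \<open>a\<close> among the nongenerators; for \<open>b\<close> this comes from
    \<open>d\<close> lying in \<open>L\<close> as well.\<close>
  then have b1: "b \<in> B1" using b_eq ab L_Int_B by blast
  define C where "C t = {s \<in> carrier G. s \<otimes> t \<otimes> inv s \<otimes> inv t \<in> M}" for t
  have sC: "subgroup (C t) G" if "t \<in> carrier G" for t
    unfolding C_def using subgroup_commuting_mod[OF sgM M_central that] by blast
  have C: "s \<in> C t" if "s \<in> carrier G" "t \<in> carrier G" "s \<otimes> t = t \<otimes> s" for s t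
  proof -
    have "s \<otimes> t \<otimes> inv s \<otimes> inv t = \<one>" using that by (simp add: word_simps)
    then show ?thesis using that subgroup.one_closed[OF sgM] by (simp add: C_def)
  qed
  have dC: "d \<in> C t" "m \<in> C t" if "t \<in> carrier G" for t
    using dM that d(1) subgroup.mem_carrier[OF sL] C[OF c(3) that M_central[OF u(2) that]]
    by (auto simp: C_def)
  have "b \<in> C x" if x: "x \<in> A" for x
  proof -
    have xc: "x \<in> carrier G" by (rule A_carrier[OF x])
    have "a \<in> C x" by (rule C[OF c(1) xc A_comm[OF aA x]])
    then have "inv a \<otimes> d \<otimes> inv m \<in> C x"
      by (intro subgroup.m_closed[OF sC[OF xc]] subgroup.m_inv_closed[OF sC[OF xc]] dC[OF xc])
    then show ?thesis using b_eq by simp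
  qed
  then have "b = \<one>" using nongenerator_B_trivial[OF b1] by (simp add: C_def)
  have "a \<in> C y" if y: "y \<in> B" for y
  proof -
    have yc: "y \<in> carrier G" by (rule B_carrier[OF y])
    have "b \<in> C y" by (rule C[OF c(2) yc critical_pair.A_comm[OF swap ab(2) y]])
    then have "d \<otimes> inv m \<otimes> inv b \<in> C y"
      by (intro subgroup.m_closed[OF sC[OF yc]] subgroup.m_inv_closed[OF sC[OF yc]] dC[OF yc])
    then show ?thesis using a_eq by simp
  qed
  then have "a = \<one>"
    using critical_triple.nongenerator_B_trivial[OF swap_triple ab(1)] by (simp add: C_def)
  then have "d = m" using u(3) ab(3) \<open>b = \<one>\<close> c by simp
  then show False using d u by simp
qed

text \<open>\<open>A1\<close> lies in both \<open>K\<close> and \<open>L\<close>, hence in the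
  central subgroup \<open>M\<close>, and \<open>A\<close> has no nontrivial central
  elements.\<close>

lemma A1_trivial: "A1 = {\<one>}"
proof -
  have "x = \<one>" if x: "x \<in> A1" for x
  proof (rule central_in_A_trivial)
    show xA: "x \<in> A" using x nongenerators_subset by blast
    have "x \<in> M" using x xA A1_subset_K A_subset_L K_Int_L_subset_M by blast
    then show "x \<otimes> y = y \<otimes> x" if "y \<in> carrier G" for y using M_central that by blast
  qed
  then show ?thesis using subgroup.one_closed[OF subgroup_nongenerators] by blast
qed

lemma minimal_A:
  assumes C: "subgroup C G" "C \<subseteq> A"
  shows "C = {\<one>} \<or> C = A"
proof (cases "C = A")
  case False
  then have "C \<subseteq> {\<one>}" using proper_subset_nongenerators[OF C(1)] C(2) A1_trivial by blast
  then show ?thesis using subgroup.one_closed[OF C(1)] by blast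
qed simp

text \<open>\<open>K\<close> is normal and contains \<open>B\<close>, \<open>L\<close> is normal and
  contains \<open>A\<close>, so the commutator lies in \<open>K \<inter> L\<close>.\<close>

lemma commutator_AB:
  assumes x: "x \<in> A" and y: "y \<in> B"
  shows "x \<otimes> y \<otimes> inv x \<otimes> inv y \<in> M"
proof -
  have c: "x \<in> carrier G" "y \<in> carrier G" using x y A_carrier B_carrier by auto
  have sL: "subgroup L G" by (rule normal_imp_subgroup[OF normal_L])
  have yK: "y \<in> K" and xL: "x \<in> L" using x y B_subset_K A_subset_L by auto
  have "x \<otimes> y \<otimes> inv x \<otimes> inv y \<in> K"
    by (intro subgroup.m_closed[OF subgroup_K] normal.inv_op_closed2[OF normal_K c(1) yK]
        subgroup.m_inv_closed[OF subgroup_K yK])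
  moreover have "x \<otimes> (y \<otimes> inv x \<otimes> inv y) \<in> L"
    by (intro subgroup.m_closed[OF sL xL] normal.inv_op_closed2[OF normal_L c(2)]
        subgroup.m_inv_closed[OF sL xL])
  ultimately show ?thesis using K_Int_L_subset_M c by (auto simp: m_assoc)
qed

lemma minimal_triple: "minimal_triple G A B M"
  by (intro minimal_triple.intro minimal_triple_axioms.intro)
    (fact is_group fin sgA sgB sgM minimal_A critical_triple.minimal_A[OF swap_triple] minM
      M_nontrivial M_central A_comm critical_pair.A_comm[OF swap] commutator_AB decomp AB_not_commute)+

end

lemma (in critical_pair) sd_le: "sd G \<le> 23 / 25"
proof (rule obtain_minimal_central)
  fix M assume M: "subgroup M G" "M \<noteq> {\<one>}"
    "\<And>m x. \<lbrakk>m \<in> M; x \<in> carrier G\<rbrakk> \<Longrightarrow> m \<otimes> x = x \<otimes> m"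
    "\<And>C. \<lbrakk>subgroup C G; C \<subseteq> M\<rbrakk> \<Longrightarrow> C = {\<one>} \<or> C = M"
  interpret critical_triple G A B \<Gamma> n M
    by (intro critical_triple.intro critical_triple_axioms.intro critical_pair_axioms) (fact M)+
  show ?thesis by (rule minimal_triple.sd_le[OF minimal_triple])
qed

section \<open>Minimal sections\<close>

context normal
begin

lemma coset_hom: "group_hom G (G Mod H) (\<lambda>x. H #> x)"
  by (intro group_hom.intro group_hom_axioms.intro is_group factorgroup_is_group r_coset_hom_Mod)

text \<open>A subgroup of \<open>G Mod H\<close> is a set of cosets, so \<open>\<Union>A\<close> is
  its preimage in \<open>G\<close>.\<close>

lemma image_Union_FactGroup:
  assumes A: "subgroup A (G Mod H)"
  shows "(\<lambda>x. H #> x) ` \<Union>A = A"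
proof
  show "(\<lambda>x. H #> x) ` \<Union>A \<subseteq> A"
    unfolding factgroup_subgroup_union_char[OF A] by blast
  show "A \<subseteq> (\<lambda>x. H #> x) ` \<Union>A"
  proof
    fix u assume u: "u \<in> A"
    then have "u \<in> carrier (G Mod H)" by (rule subgroup.mem_carrier[OF A])
    then obtain x where "x \<in> carrier G" "u = H #> x" by (auto simp: carrier_FactGroup)
    with u show "u \<in> (\<lambda>x. H #> x) ` \<Union>A"
      unfolding factgroup_subgroup_union_char[OF A] by blast
  qed
qed

lemma Union_FactGroup_carrier:
  assumes "subgroup A (G Mod H)"
  shows "\<Union>A \<subseteq> carrier G"
  using factgroup_subgroup_union_char[OF assms] by blast

lemma subset_Union_FactGroup:
  assumes A: "subgroup A (G Mod H)"
  shows "H \<subseteq> \<Union>A"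
  using subgroup.one_closed[OF A] by auto

lemma FactGroup_commute_if_Union_commute:
  assumes A: "subgroup A (G Mod H)" and B: "subgroup B (G Mod H)"
    and com: "\<Union>A <#> \<Union>B = \<Union>B <#> \<Union>A"
  shows "A <#>\<^bsub>G Mod H\<^esub> B = B <#>\<^bsub>G Mod H\<^esub> A"
proof -
  note hom = set_mult_hom[OF r_coset_hom_Mod]
  note car = Union_FactGroup_carrier[OF A] Union_FactGroup_carrier[OF B]
  show ?thesis
    using hom[OF car] hom[OF car(2,1)] com
    by (simp add: image_Union_FactGroup[OF A] image_Union_FactGroup[OF B])
qed

text \<open>Equality of the image products gives \<open>s = h \<otimes> t\<close> with
  \<open>h\<close> in \<open>H\<close>, and \<open>h\<close> is absorbed because
  \<open>H \<subseteq> V\<close>.\<close>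

lemma commute_if_FactGroup_commute:
  assumes U: "subgroup U G" "H \<subseteq> U" and V: "subgroup V G" "H \<subseteq> V"
    and com: "(\<lambda>x. H #> x) ` U <#>\<^bsub>G Mod H\<^esub> (\<lambda>x. H #> x) ` V
      = (\<lambda>x. H #> x) ` V <#>\<^bsub>G Mod H\<^esub> (\<lambda>x. H #> x) ` U"
  shows "U <#> V = V <#> U"
proof (rule set_mult_commute_if_subset[OF U(1) V(1)], rule subsetI)
  note car = subgroup.subset[OF U(1)] subgroup.subset[OF V(1)]
  have img: "(\<lambda>x. H #> x) ` (U <#> V) = (\<lambda>x. H #> x) ` (V <#> U)"
    using set_mult_hom[OF r_coset_hom_Mod car] set_mult_hom[OF r_coset_hom_Mod car(2,1)] com by simp
  fix s assume s: "s \<in> U <#> V"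
  then have "H #> s \<in> (\<lambda>x. H #> x) ` (V <#> U)" unfolding img[symmetric] by blast
  then obtain t where t: "t \<in> V <#> U" "H #> s = H #> t" by blast
  have "s \<in> carrier G" using s setmult_subset_G[OF car] by blast
  then have "s \<in> H #> t" using rcos_self[OF _ subgroup_axioms] t by blast
  then obtain h where h: "h \<in> H" "s = h \<otimes> t" by (auto simp: r_coset_def)
  obtain v u where vu: "v \<in> V" "u \<in> U" "t = v \<otimes> u" using t(1) by (rule set_multE)
  have "s = (h \<otimes> v) \<otimes> u" using h vu car subset by (simp add: m_assoc subset_iff)
  moreover have "h \<otimes> v \<in> V" using h vu V by (auto intro: subgroup.m_closed)
  ultimately show "s \<in> V <#> U" using vu by (simp add: set_multI)
qed

lemma central_chain_FactGroup:
  assumes ch: "central_chain G \<Gamma> n"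
  shows "central_chain (G Mod H) (\<lambda>i. (\<lambda>x. H #> x) ` \<Gamma> i) n"
  unfolding central_chain_def
proof (intro conjI allI ballI)
  interpret \<pi>: group_hom G "G Mod H" "\<lambda>x. H #> x" by (rule coset_hom)
  show "(\<lambda>x. H #> x) ` \<Gamma> 0 = carrier (G Mod H)"
    using ch by (simp add: central_chain_def carrier_FactGroup)
  show "(\<lambda>x. H #> x) ` \<Gamma> n \<subseteq> {\<one>\<^bsub>G Mod H\<^esub>}"
    using ch \<pi>.hom_one by (auto simp: central_chain_def)
  show "(\<lambda>x. H #> x) ` \<Gamma> i \<subseteq> carrier (G Mod H)" for i
    unfolding carrier_FactGroup using ch by (intro image_mono) (simp add: central_chain_def)
  fix i u v assume "u \<in> (\<lambda>x. H #> x) ` \<Gamma> i" "v \<in> carrier (G Mod H)"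
  then obtain x y where x: "x \<in> \<Gamma> i" "u = H #> x" and y: "y \<in> carrier G" "v = H #> y"
    by (auto simp: carrier_FactGroup)
  have xc: "x \<in> carrier G" using ch x by (auto simp: central_chain_def)
  have "u \<otimes>\<^bsub>G Mod H\<^esub> v \<otimes>\<^bsub>G Mod H\<^esub> inv\<^bsub>G Mod H\<^esub> u \<otimes>\<^bsub>G Mod H\<^esub> inv\<^bsub>G Mod H\<^esub> v
    = H #> (x \<otimes> y \<otimes> inv x \<otimes> inv y)"
    unfolding x(2) y(2) using xc y(1)
    by (simp only: \<pi>.hom_mult[symmetric] \<pi>.hom_inv[symmetric] m_closed inv_closed)
  moreover have "x \<otimes> y \<otimes> inv x \<otimes> inv y \<in> \<Gamma> (Suc i)"
    using ch x y by (auto simp: central_chain_def)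
  ultimately show "u \<otimes>\<^bsub>G Mod H\<^esub> v \<otimes>\<^bsub>G Mod H\<^esub> inv\<^bsub>G Mod H\<^esub> u \<otimes>\<^bsub>G Mod H\<^esub> inv\<^bsub>G Mod H\<^esub> v
    \<in> (\<lambda>x. H #> x) ` \<Gamma> (Suc i)" by simp
qed

text \<open>The hypotheses \<open>proper\<close> and \<open>quotient\<close> are those of
  \<open>critical_pair\<close> for \<open>G Mod H\<close>, pulled back to \<open>G\<close>. A
  non-commuting pair of subgroups of the quotient with least sum of orders provides \<open>A\<close>
  and \<open>B\<close>.\<close>

lemma sd_FactGroup_le:
  assumes fin: "finite (carrier G)" and ch: "central_chain G \<Gamma> n"
    and proper: "\<And>K U V. \<lbrakk>subgroup K G; K \<noteq> carrier G; subgroup U G; subgroup V G; U \<subseteq> K; V \<subseteq> K\<rbrakk>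
      \<Longrightarrow> U <#> V = V <#> U"
    and quotient: "\<And>W U V. \<lbrakk>W \<lhd> G; H \<subset> W; subgroup U G; subgroup V G; W \<subseteq> U; W \<subseteq> V\<rbrakk>
      \<Longrightarrow> U <#> V = V <#> U"
    and U0: "subgroup U0 G" "H \<subseteq> U0" and V0: "subgroup V0 G" "H \<subseteq> V0"
    and ne: "U0 <#> V0 \<noteq> V0 <#> U0"
  shows "sd (G Mod H) \<le> 23 / 25"
proof -
  let ?S = "G Mod H"
  let ?\<pi> = "\<lambda>x. H #> x"
  interpret S: group ?S by (rule factorgroup_is_group)
  have finS: "finite (carrier ?S)" using fin by (simp add: carrier_FactGroup)
  let ?P = "\<lambda>p. subgroup (fst p) ?S \<and> subgroup (snd p) ?S \<and> fst p <#>\<^bsub>?S\<^esub> snd p \<noteq> snd p <#>\<^bsub>?S\<^esub> fst p"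
  have "?P (?\<pi> ` U0, ?\<pi> ` V0)"
    using group_hom.subgroup_img_is_subgroup[OF coset_hom U0(1)]
      group_hom.subgroup_img_is_subgroup[OF coset_hom V0(1)]
      commute_if_FactGroup_commute[OF U0 V0] ne by auto
  from ex_has_least_nat[of ?P, OF this, of "\<lambda>p. card (fst p) + card (snd p)"]
  obtain p where "?P p \<and> (\<forall>q. ?P q \<longrightarrow> card (fst p) + card (snd p) \<le> card (fst q) + card (snd q))"
    by (rule exE)
  moreover define A B where "A = fst p" and "B = snd p"
  ultimately have A: "subgroup A ?S" and B: "subgroup B ?S"
    and AB: "A <#>\<^bsub>?S\<^esub> B \<noteq> B <#>\<^bsub>?S\<^esub> A"
    and least: "\<And>C D. \<lbrakk>subgroup C ?S; subgroup D ?S; C <#>\<^bsub>?S\<^esub> D \<noteq> D <#>\<^bsub>?S\<^esub> C\<rbrakk>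
      \<Longrightarrow> card A + card B \<le> card C + card D"
    by auto
  have fA: "finite A" and fB: "finite B"
    using finite_subset[OF subgroup.subset finS] A B by blast+
  interpret critical_pair ?S A B "\<lambda>i. ?\<pi> ` \<Gamma> i" n
  proof (intro critical_pair.intro critical_pair_axioms.intro)
    show "C <#>\<^bsub>?S\<^esub> B = B <#>\<^bsub>?S\<^esub> C" if "subgroup C ?S" "C \<subset> A" for C
      using least[OF that(1) B] psubset_card_mono[OF fA that(2)] by fastforce
    show "C <#>\<^bsub>?S\<^esub> A = A <#>\<^bsub>?S\<^esub> C" if "subgroup C ?S" "C \<subset> B" for C
      using least[OF A that(1)] psubset_card_mono[OF fB that(2)] by fastforce
  next
    fix K U V assume K: "subgroup K ?S" "K \<noteq> carrier ?S" and U: "subgroup U ?S" "U \<subseteq> K"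
      and V: "subgroup V ?S" "V \<subseteq> K"
    have "\<Union>K \<noteq> carrier G"
      using image_Union_FactGroup[OF K(1)] K(2) by (auto simp: carrier_FactGroup)
    then have "\<Union>U <#> \<Union>V = \<Union>V <#> \<Union>U"
      using U V by (intro proper[OF factgroup_subgroup_union_subgroup[OF K(1)]]
        factgroup_subgroup_union_subgroup Union_mono)
    then show "U <#>\<^bsub>?S\<^esub> V = V <#>\<^bsub>?S\<^esub> U"
      by (rule FactGroup_commute_if_Union_commute[OF U(1) V(1)])
  next
    fix W U V assume W: "W \<lhd> ?S" "W \<noteq> {\<one>\<^bsub>?S\<^esub>}" and U: "subgroup U ?S" "W \<subseteq> U"
      and V: "subgroup V ?S" "W \<subseteq> V"
    have sW: "subgroup W ?S" by (rule normal_imp_subgroup[OF W(1)])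
    \<comment> \<open>A subgroup of the quotient whose preimage is only \<open>H\<close> is trivial;
      this gives the strict inclusion that \<open>quotient\<close> requires.\<close>
    have "\<Union>W \<noteq> H"
    proof
      assume "\<Union>W = H"
      then have "W = ?\<pi> ` H" using image_Union_FactGroup[OF sW] by simp
      also have "\<dots> = (\<lambda>x. H) ` H"
        using coset_join2[OF _ subgroup_axioms] by (intro image_cong) auto
      also have "\<dots> = {H}" using subgroup.one_closed[OF subgroup_axioms] by (intro image_constant)
      finally show False using W(2) by simp
    qed
    then have "H \<subset> \<Union>W" using subset_Union_FactGroup[OF sW] by blast
    then have "\<Union>U <#> \<Union>V = \<Union>V <#> \<Union>U"
      using U V by (intro quotient[OF factgroup_subgroup_union_normal[OF W(1)]]
        factgroup_subgroup_union_subgroup Union_mono)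
    then show "U <#>\<^bsub>?S\<^esub> V = V <#>\<^bsub>?S\<^esub> U"
      by (rule FactGroup_commute_if_Union_commute[OF U(1) V(1)])
  qed (fact S.is_group finS A B AB central_chain_FactGroup[OF ch])+
  show ?thesis by (rule sd_le)
qed

end

section \<open>Choice of a minimal section\<close>

context group
begin

lemma central_chain_subgroup:
  assumes ch: "central_chain G \<Gamma> n" and H: "subgroup H G"
  shows "central_chain (G\<lparr>carrier := H\<rparr>) (\<lambda>i. \<Gamma> i \<inter> H) n"
  unfolding central_chain_def
proof (intro conjI allI ballI)
  show "\<Gamma> 0 \<inter> H = carrier (G\<lparr>carrier := H\<rparr>)"
    using ch subgroup.subset[OF H] by (auto simp: central_chain_def)
  show "\<Gamma> n \<inter> H \<subseteq> {\<one>\<^bsub>G\<lparr>carrier := H\<rparr>\<^esub>}" using ch by (auto simp: central_chain_def)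
  show "\<Gamma> i \<inter> H \<subseteq> carrier (G\<lparr>carrier := H\<rparr>)" for i by simp
  fix i x y assume x: "x \<in> \<Gamma> i \<inter> H" and y: "y \<in> carrier (G\<lparr>carrier := H\<rparr>)"
  then have y: "y \<in> H" by simp
  have "x \<otimes> y \<otimes> inv x \<otimes> inv y \<in> H"
    using x y H by (simp add: subgroup.m_closed subgroup.m_inv_closed)
  moreover have "x \<otimes> y \<otimes> inv x \<otimes> inv y \<in> \<Gamma> (Suc i)"
    using ch x y subgroup.mem_carrier[OF H] by (auto simp: central_chain_def)
  ultimately show "x \<otimes>\<^bsub>G\<lparr>carrier := H\<rparr>\<^esub> y \<otimes>\<^bsub>G\<lparr>carrier := H\<rparr>\<^esub> inv\<^bsub>G\<lparr>carrier := H\<rparr>\<^esub> x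
      \<otimes>\<^bsub>G\<lparr>carrier := H\<rparr>\<^esub> inv\<^bsub>G\<lparr>carrier := H\<rparr>\<^esub> y \<in> \<Gamma> (Suc i) \<inter> H"
    using x y H by simp
qed

lemma nilpotent_imp_central_chain:
  assumes "nilpotent_group G"
  obtains n where "central_chain G (lower_central G) n"
proof -
  obtain n where n: "lower_central G n = {\<one>}" using assms by (auto simp: nilpotent_group_def)
  have sub: "lower_central G i \<subseteq> carrier G" for i
  proof (induction i)
    case (Suc i)
    then show ?case by (auto intro!: generate_incl)
  qed simp
  have "central_chain G (lower_central G) n"
    using n sub by (auto simp: central_chain_def intro!: generate.incl)
  then show thesis by (rule that)
qed

text \<open>\<open>H\<close> is a smallest subgroup containing a non-commuting pair, and
  \<open>N\<close> a largest normal subgroup of \<open>H\<close> such that some non-commuting pair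
  in \<open>H\<close> lies above \<open>N\<close>. The choice of \<open>H\<close> gives the
  condition on proper subgroups, that of \<open>N\<close> the condition on quotients.\<close>

lemma exists_section_sd_le:
  assumes fin: "finite (carrier G)" and ch: "central_chain G \<Gamma> n"
    and UV: "subgroup U G" "subgroup V G" "U <#> V \<noteq> V <#> U"
  shows "\<exists>S\<in>sections G. sd S \<le> 23 / 25"
proof -
  let ?Q = "\<lambda>H. subgroup H G \<and> (\<exists>U V. subgroup U G \<and> subgroup V G \<and> U \<subseteq> H \<and> V \<subseteq> H \<and> U <#> V \<noteq> V <#> U)"
  have "?Q (carrier G)" using UV subgroup_self subgroup.subset by blast
  from ex_has_least_nat[of ?Q, OF this, of card]
  obtain H where "?Q H \<and> (\<forall>K. ?Q K \<longrightarrow> card H \<le> card K)" by (rule exE)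
  then have H: "subgroup H G" and QH: "?Q H" and leastH: "\<And>K. ?Q K \<Longrightarrow> card H \<le> card K" by auto
  let ?F = "G\<lparr>carrier := H\<rparr>"
  interpret F: group ?F by (rule subgroup_imp_group[OF H])
  have finH: "finite H" by (rule finite_subset[OF subgroup.subset[OF H] fin])
  have sub_iff: "subgroup U ?F \<longleftrightarrow> subgroup U G \<and> U \<subseteq> H" for U
    using incl_subgroup[OF H] subgroup_incl[OF _ H] subgroup.subset[of U ?F] by auto
  let ?R = "\<lambda>N. N \<lhd> ?F \<and> (\<exists>U V. subgroup U ?F \<and> subgroup V ?F \<and> N \<subseteq> U \<and> N \<subseteq> V \<and> U <#> V \<noteq> V <#> U)"
  have "?R {\<one>}"
  proof -
    have "{\<one>} \<lhd> ?F" using F.one_is_normal by simp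
    moreover obtain U V where UV: "subgroup U ?F" "subgroup V ?F" "U <#> V \<noteq> V <#> U"
      using QH sub_iff by blast
    moreover have "{\<one>} \<subseteq> U" "{\<one>} \<subseteq> V"
      using UV sub_iff subgroup.one_closed by blast+
    ultimately show ?thesis by blast
  qed
  \<comment> \<open>Minimizing the difference of the orders selects an \<open>N\<close> of largest
    order.\<close>
  from ex_has_least_nat[of ?R, OF this, of "\<lambda>N. card H - card N"]
  obtain N where N: "?R N \<and> (\<forall>K. ?R K \<longrightarrow> card H - card N \<le> card H - card K)" by (rule exE)
  then have nN: "N \<lhd> ?F" and leastN: "\<And>K. ?R K \<Longrightarrow> card H - card N \<le> card H - card K" by auto
  obtain U0 V0 where U0: "subgroup U0 ?F" "N \<subseteq> U0" and V0: "subgroup V0 ?F" "N \<subseteq> V0"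
    and ne: "U0 <#> V0 \<noteq> V0 <#> U0" using N by blast
  have "sd (?F Mod N) \<le> 23 / 25"
  proof (rule normal.sd_FactGroup_le[OF nN _ central_chain_subgroup[OF ch H] _ _ U0 V0])
    show "finite (carrier ?F)" using finH by simp
    show "U0 <#>\<^bsub>?F\<^esub> V0 \<noteq> V0 <#>\<^bsub>?F\<^esub> U0" using ne by simp
  next
    fix K U V assume K: "subgroup K ?F" "K \<noteq> carrier ?F" and U: "subgroup U ?F" "U \<subseteq> K"
      and V: "subgroup V ?F" "V \<subseteq> K"
    have "K \<subset> H" using K sub_iff by auto
    then have "card K < card H" by (rule psubset_card_mono[OF finH])
    have "\<not> ?Q K"
    proof
      assume "?Q K"
      then have "card H \<le> card K" by (rule leastH)
      with \<open>card K < card H\<close> show False by simp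
    qed
    then have "U <#> V = V <#> U" using K U V sub_iff by blast
    then show "U <#>\<^bsub>?F\<^esub> V = V <#>\<^bsub>?F\<^esub> U" by simp
  next
    fix W U V assume W: "W \<lhd> ?F" "N \<subset> W" and U: "subgroup U ?F" "W \<subseteq> U"
      and V: "subgroup V ?F" "W \<subseteq> V"
    have WH: "W \<subseteq> H" using normal_imp_subgroup[OF W(1)] sub_iff by blast
    have "card N < card W" using W(2) finite_subset[OF WH finH] by (rule psubset_card_mono[rotated])
    \<comment> \<open>Subtraction of naturals truncates at 0; this bound keeps the comparison of the
      two differences strict.\<close>
    moreover have "card W \<le> card H" by (rule card_mono[OF finH WH])
    ultimately have less: "card H - card W < card H - card N" by simp
    have "\<not> ?R W"
    proof
      assume "?R W"
      then have "card H - card N \<le> card H - card W" by (rule leastN)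
      with less show False by simp
    qed
    then have "U <#> V = V <#> U" using W U V by blast
    then show "U <#>\<^bsub>?F\<^esub> V = V <#>\<^bsub>?F\<^esub> U" by simp
  qed
  moreover have "?F Mod N \<in> sections G" using H nN by (auto simp: sections_def)
  ultimately show ?thesis by blast
qed

text \<open>Finiteness is what makes the \<open>Min\<close> in \<open>sd_star\<close> a lower bound.
  It holds because a section is determined by two subsets of the carrier.\<close>

lemma finite_sections:
  assumes fin: "finite (carrier G)"
  shows "finite (sections G)"
proof (rule finite_subset)
  show "sections G \<subseteq> (\<lambda>(H, N). (G\<lparr>carrier := H\<rparr>) Mod N) ` (Pow (carrier G) \<times> Pow (carrier G))"
  proof
    fix S assume "S \<in> sections G"
    then obtain H N where S: "S = (G\<lparr>carrier := H\<rparr>) Mod N" "subgroup H G" "N \<lhd> G\<lparr>carrier := H\<rparr>"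
      by (auto simp: sections_def)
    have "N \<subseteq> H" using subgroup.subset[OF normal_imp_subgroup[OF S(3)]] by simp
    then show "S \<in> (\<lambda>(H, N). (G\<lparr>carrier := H\<rparr>) Mod N) ` (Pow (carrier G) \<times> Pow (carrier G))"
      using S(1) subgroup.subset[OF S(2)] by (intro image_eqI[of _ _ "(H, N)"]) auto
  qed
qed (use fin in simp)

end

theorem theorem1:
  fixes G :: "('a, 'b) monoid_scheme"
  assumes "group G"
    and "finite (carrier G)"
    and "nilpotent_group G"
    and "sd_star G > 23 / 25"
  shows "modular_group G \<and> iwasawa_group G"
proof -
  interpret group G by fact
  obtain n where ch: "central_chain G (lower_central G) n"
    by (rule nilpotent_imp_central_chain[OF assms(3)])
  have "modular_group G"
  proof (rule commuting_subgroups_imp_modular, rule ccontr)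
    fix U V assume UV: "subgroup U G" "subgroup V G" "U <#>\<^bsub>G\<^esub> V \<noteq> V <#>\<^bsub>G\<^esub> U"
    obtain S where S: "S \<in> sections G" "sd S \<le> 23 / 25"
      using exists_section_sd_le[OF assms(2) ch UV] by blast
    have "sd_star G \<le> sd S"
      unfolding sd_star_def using S(1) finite_sections[OF assms(2)] by (intro Min_le) auto
    then show False using S(2) assms(4) by simp
  qed
  then show ?thesis using assms by (simp add: iwasawa_group_def)
qed

end
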